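(* For every semiring $R$ and every $n\geq1$, the matrix semiring $M_n(R)$ satisfies: (i) $\mathcal{R}_{BM}(M_n(R))=M_n(\mathcal{R}_{BM}(R))$; (ii) $J_s(M_n(R))=M_n(J_s(R))$; (iii) $J(M_n(R))=M_n(J(R))$.
   Context: A hemiring $(R,+,\cdot,0)$ consists of a commutative monoid $(R,+,0)$ and a semigroup $(R,\cdot)$ such that multiplication distributes over addition on both sides and $0r=0=r0$ for all $r$. A semiring is a hemiring with a multiplicative identity $1$. Ideals are two-sided and are regarded as hemirings. A left $R$-semimodule is a commutative monoid $(M,+,0_M)$ with a scalar multiplication $R\times M\to M$ satisfying $(rr')m=r(r'm)$, $r(m+m')=rm+rm'$, $(r+r')m=rm+r'm$, $r0_M=0_M=0m$. Write $(0:M)_R=\{r\in R\mid rM=0\}$. Brown-McCoy radical: a hemiring $R$ is ideal-simple if its only ideals are $0$ and $R$. Let $\mathcal{U}\mathbb{S}$ be the class of all hemirings having no nonzero homomorphic image that is an ideal-simple semiring. $\mathcal{R}_{BM}(R)$ is the union of all ideals of $R$ belonging to $\mathcal{U}\mathbb{S}$ (it is the greatest such ideal). $J_s$: a left $R$-semimodule $M$ is simple if $RM\neq0$, its only subsemimodules are $0$ and $M$, and its only semimodule congruences are the diagonal and $M^2$. $J_s(R):=\bigcap(0:M)_R$ over all simple left $R$-semimodules $M$ (equal to $R$ if there are none). Jacobson(-Bourne) radical: a right ideal $I$ of $R$ is right semiregular if for all $i_1,i_2\in I$ there are $j_1,j_2\in I$ with $i_1+j_1+i_1j_1+i_2j_2=i_2+j_2+i_1j_2+i_2j_1$;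 $J(R)$ is the sum of all right semiregular right ideals of $R$. Equivalently (known), $J(R)=\bigcap(0:M)_R$ over all irreducible left $R$-semimodules $M$ (with $J(R)=R$ if there are none), where a nonzero additively cancellative left semimodule $M$ is irreducible if for all $m_1\neq m_2$ and $m$ in $M$ there are $r_1,r_2\in R$ with $m+r_1m_1+r_2m_2=r_1m_2+r_2m_1$. *)

theory Defs
  imports "Jordan_Normal_Form.Matrix"
begin

section \<open>Hemirings, ideals, homomorphisms\<close>

text \<open>
  A semiring is the library's \<^locale>\<open>Ring.semiring\<close>. A hemiring is carried by the same record,
  whose field \<open>one\<close> is then meaningless.
\<close>

locale hemiring = abelian_monoid R for R (structure) +
  assumes m_closed: "\<lbrakk>x \<in> carrier R; y \<in> carrier R\<rbrakk> \<Longrightarrow> x \<otimes> y \<in> carrier R"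
    and m_assoc: "\<lbrakk>x \<in> carrier R; y \<in> carrier R; z \<in> carrier R\<rbrakk> \<Longrightarrow> (x \<otimes> y) \<otimes> z = x \<otimes> (y \<otimes> z)"
    and l_distr: "\<lbrakk>x \<in> carrier R; y \<in> carrier R; z \<in> carrier R\<rbrakk> \<Longrightarrow> (x \<oplus> y) \<otimes> z = x \<otimes> z \<oplus> y \<otimes> z"
    and r_distr: "\<lbrakk>x \<in> carrier R; y \<in> carrier R; z \<in> carrier R\<rbrakk> \<Longrightarrow> z \<otimes> (x \<oplus> y) = z \<otimes> x \<oplus> z \<otimes> y"
    and l_null: "x \<in> carrier R \<Longrightarrow> \<zero> \<otimes> x = \<zero>"
    and r_null: "x \<in> carrier R \<Longrightarrow> x \<otimes> \<zero> = \<zero>"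

definition hemiring_ideal :: "('a, 'b) ring_scheme \<Rightarrow> 'a set \<Rightarrow> bool" where
  "hemiring_ideal R I \<longleftrightarrow>
     I \<subseteq> carrier R \<and> \<zero>\<^bsub>R\<^esub> \<in> I \<and>
     (\<forall>x\<in>I. \<forall>y\<in>I. x \<oplus>\<^bsub>R\<^esub> y \<in> I) \<and>
     (\<forall>r\<in>carrier R. \<forall>x\<in>I. r \<otimes>\<^bsub>R\<^esub> x \<in> I \<and> x \<otimes>\<^bsub>R\<^esub> r \<in> I)"

definition right_hemiring_ideal :: "('a, 'b) ring_scheme \<Rightarrow> 'a set \<Rightarrow> bool" where
  "right_hemiring_ideal R I \<longleftrightarrow>
     I \<subseteq> carrier R \<and> \<zero>\<^bsub>R\<^esub> \<in> I \<and>
     (\<forall>x\<in>I. \<forall>y\<in>I. x \<oplus>\<^bsub>R\<^esub> y \<in> I) \<and>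
     (\<forall>r\<in>carrier R. \<forall>x\<in>I. x \<otimes>\<^bsub>R\<^esub> r \<in> I)"

definition hemiring_hom :: "('a, 'b) ring_scheme \<Rightarrow> ('c, 'd) ring_scheme \<Rightarrow> ('a \<Rightarrow> 'c) set" where
  "hemiring_hom R S =
     {f \<in> carrier R \<rightarrow> carrier S. f \<zero>\<^bsub>R\<^esub> = \<zero>\<^bsub>S\<^esub> \<and>
        (\<forall>x\<in>carrier R. \<forall>y\<in>carrier R.
           f (x \<oplus>\<^bsub>R\<^esub> y) = f x \<oplus>\<^bsub>S\<^esub> f y \<and> f (x \<otimes>\<^bsub>R\<^esub> y) = f x \<otimes>\<^bsub>S\<^esub> f y)}"

section \<open>Brown-McCoy radical\<close>

definition ideal_simple :: "('a, 'b) ring_scheme \<Rightarrow> bool" where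
  "ideal_simple R \<longleftrightarrow> (\<forall>I. hemiring_ideal R I \<longrightarrow> I = {\<zero>\<^bsub>R\<^esub>} \<or> I = carrier R)"

text \<open>
  The images \<open>S\<close> range over structures on the element type of \<open>R\<close>. Every homomorphic image of
  \<open>R\<close> is isomorphic to one of these; see \<open>brown_mccoy_class_image\<close> below. A homomorphism is not
  required to preserve the \<open>one\<close> fields.
\<close>

definition brown_mccoy_class :: "('a, 'b) ring_scheme \<Rightarrow> bool" where
  "brown_mccoy_class R \<longleftrightarrow> hemiring R \<and>
     \<not> (\<exists>(S :: 'a ring) f. f \<in> hemiring_hom R S \<and> f ` carrier R = carrier S \<and>
           carrier S \<noteq> {\<zero>\<^bsub>S\<^esub>} \<and> Ring.semiring S \<and> ideal_simple S)"

definition brown_mccoy_radical :: "('a, 'b) ring_scheme \<Rightarrow> 'a set" where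
  "brown_mccoy_radical R =
     \<Union> {I. hemiring_ideal R I \<and> brown_mccoy_class (R\<lparr>carrier := I\<rparr>)}"

section \<open>Semimodules and the radical of simple semimodules\<close>

text \<open>
  The library's record \<open>module\<close> extends \<open>ring\<close>; its fields \<open>mult\<close> and \<open>one\<close> play no role. The
  scalar action is not assumed to be unitary, even when \<open>R\<close> is a semiring.
\<close>

locale left_semimodule = R?: hemiring R + M?: abelian_monoid M
  for R (structure) and M :: "('a, 'b, 'c) module_scheme" (structure) +
  assumes smult_closed: "\<lbrakk>r \<in> carrier R; m \<in> carrier M\<rbrakk> \<Longrightarrow> r \<odot>\<^bsub>M\<^esub> m \<in> carrier M"
    and smult_assoc: "\<lbrakk>r \<in> carrier R; s \<in> carrier R; m \<in> carrier M\<rbrakk>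
          \<Longrightarrow> (r \<otimes>\<^bsub>R\<^esub> s) \<odot>\<^bsub>M\<^esub> m = r \<odot>\<^bsub>M\<^esub> (s \<odot>\<^bsub>M\<^esub> m)"
    and smult_r_distr: "\<lbrakk>r \<in> carrier R; m \<in> carrier M; m' \<in> carrier M\<rbrakk>
          \<Longrightarrow> r \<odot>\<^bsub>M\<^esub> (m \<oplus>\<^bsub>M\<^esub> m') = r \<odot>\<^bsub>M\<^esub> m \<oplus>\<^bsub>M\<^esub> r \<odot>\<^bsub>M\<^esub> m'"
    and smult_l_distr: "\<lbrakk>r \<in> carrier R; s \<in> carrier R; m \<in> carrier M\<rbrakk>
          \<Longrightarrow> (r \<oplus>\<^bsub>R\<^esub> s) \<odot>\<^bsub>M\<^esub> m = r \<odot>\<^bsub>M\<^esub> m \<oplus>\<^bsub>M\<^esub> s \<odot>\<^bsub>M\<^esub> m"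
    and smult_r_null: "r \<in> carrier R \<Longrightarrow> r \<odot>\<^bsub>M\<^esub> \<zero>\<^bsub>M\<^esub> = \<zero>\<^bsub>M\<^esub>"
    and smult_l_null: "m \<in> carrier M \<Longrightarrow> \<zero>\<^bsub>R\<^esub> \<odot>\<^bsub>M\<^esub> m = \<zero>\<^bsub>M\<^esub>"

definition subsemimodule :: "('a, 'b) ring_scheme \<Rightarrow> ('a, 'c, 'd) module_scheme \<Rightarrow> 'c set \<Rightarrow> bool" where
  "subsemimodule R M N \<longleftrightarrow>
     N \<subseteq> carrier M \<and> \<zero>\<^bsub>M\<^esub> \<in> N \<and>
     (\<forall>x\<in>N. \<forall>y\<in>N. x \<oplus>\<^bsub>M\<^esub> y \<in> N) \<and>
     (\<forall>r\<in>carrier R. \<forall>x\<in>N. r \<odot>\<^bsub>M\<^esub> x \<in> N)"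

definition semimodule_congruence ::
    "('a, 'b) ring_scheme \<Rightarrow> ('a, 'c, 'd) module_scheme \<Rightarrow> ('c \<times> 'c) set \<Rightarrow> bool" where
  "semimodule_congruence R M C \<longleftrightarrow>
     equiv (carrier M) C \<and>
     (\<forall>x x' y y'. (x, x') \<in> C \<longrightarrow> (y, y') \<in> C \<longrightarrow> (x \<oplus>\<^bsub>M\<^esub> y, x' \<oplus>\<^bsub>M\<^esub> y') \<in> C) \<and>
     (\<forall>r\<in>carrier R. \<forall>x x'. (x, x') \<in> C \<longrightarrow> (r \<odot>\<^bsub>M\<^esub> x, r \<odot>\<^bsub>M\<^esub> x') \<in> C)"

definition simple_semimodule :: "('a, 'b) ring_scheme \<Rightarrow> ('a, 'c, 'd) module_scheme \<Rightarrow> bool" where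
  "simple_semimodule R M \<longleftrightarrow>
     left_semimodule R M \<and>
     (\<exists>r\<in>carrier R. \<exists>m\<in>carrier M. r \<odot>\<^bsub>M\<^esub> m \<noteq> \<zero>\<^bsub>M\<^esub>) \<and>
     (\<forall>N. subsemimodule R M N \<longrightarrow> N = {\<zero>\<^bsub>M\<^esub>} \<or> N = carrier M) \<and>
     (\<forall>C. semimodule_congruence R M C \<longrightarrow> C = Id_on (carrier M) \<or> C = carrier M \<times> carrier M)"

definition semimodule_annihilator :: "('a, 'b) ring_scheme \<Rightarrow> ('a, 'c, 'd) module_scheme \<Rightarrow> 'a set" where
  "semimodule_annihilator R M = {r \<in> carrier R. \<forall>m\<in>carrier M. r \<odot>\<^bsub>M\<^esub> m = \<zero>\<^bsub>M\<^esub>}"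

text \<open>
  The semimodules \<open>M\<close> range over structures on the element type of \<open>R\<close>. A simple semimodule has
  the form \<open>Rm\<close>, hence is isomorphic to one of these; see \<open>simple_radical_annihilates\<close> below.
\<close>

definition simple_radical :: "('a, 'b) ring_scheme \<Rightarrow> 'a set" where
  "simple_radical R =
     {r \<in> carrier R. \<forall>M :: ('a, 'a) module. simple_semimodule R M \<longrightarrow> r \<in> semimodule_annihilator R M}"

section \<open>Jacobson-Bourne radical\<close>

definition right_semiregular :: "('a, 'b) ring_scheme \<Rightarrow> 'a set \<Rightarrow> bool" where
  "right_semiregular R I \<longleftrightarrow>
     right_hemiring_ideal R I \<and>
     (\<forall>i1\<in>I. \<forall>i2\<in>I. \<exists>j1\<in>I. \<exists>j2\<in>I.
        i1 \<oplus>\<^bsub>R\<^esub> j1 \<oplus>\<^bsub>R\<^esub> i1 \<otimes>\<^bsub>R\<^esub> j1 \<oplus>\<^bsub>R\<^esub> i2 \<otimes>\<^bsub>R\<^esub> j2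
        = i2 \<oplus>\<^bsub>R\<^esub> j2 \<oplus>\<^bsub>R\<^esub> i1 \<otimes>\<^bsub>R\<^esub> j2 \<oplus>\<^bsub>R\<^esub> i2 \<otimes>\<^bsub>R\<^esub> j1)"

text \<open>The sum of a family of right ideals consists of the finite sums of elements of its members.\<close>

definition jacobson_radical :: "('a, 'b) ring_scheme \<Rightarrow> 'a set" where
  "jacobson_radical R =
     {(\<Oplus>\<^bsub>R\<^esub>I\<in>F. f I) | F f. finite F \<and> F \<subseteq> {I. right_semiregular R I} \<and> (\<forall>I\<in>F. f I \<in> I)}"

section \<open>Matrix semirings\<close>

definition matrices_over :: "nat \<Rightarrow> 'a set \<Rightarrow> 'a mat set" where
  "matrices_over n X = {A \<in> carrier_mat n n. \<forall>i<n. \<forall>j<n. A $$ (i, j) \<in> X}"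

text \<open>
  The library's \<^const>\<open>ring_mat\<close> takes its entries in a whole type of class \<open>semiring_1\<close>, so it
  does not apply to a semiring with a carrier set.
\<close>

definition matrix_semiring :: "nat \<Rightarrow> ('a, 'b) ring_scheme \<Rightarrow> 'a mat ring" where
  "matrix_semiring n R =
     \<lparr>carrier = matrices_over n (carrier R),
      mult = (\<lambda>A B. mat n n (\<lambda>(i, j). \<Oplus>\<^bsub>R\<^esub>k\<in>{..<n}. A $$ (i, k) \<otimes>\<^bsub>R\<^esub> B $$ (k, j))),
      one = mat n n (\<lambda>(i, j). if i = j then \<one>\<^bsub>R\<^esub> else \<zero>\<^bsub>R\<^esub>),
      zero = mat n n (\<lambda>(i, j). \<zero>\<^bsub>R\<^esub>),
      add = (\<lambda>A B. mat n n (\<lambda>(i, j). A $$ (i, j) \<oplus>\<^bsub>R\<^esub> B $$ (i, j)))\<rparr>"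

section \<open>Adequacy of the definitions\<close>

lemma semiring_imp_hemiring:
  assumes "Ring.semiring R"
  shows "hemiring R"
proof -
  interpret Ring.semiring R by fact
  show ?thesis by unfold_locales (auto simp: m_assoc l_distr r_distr)
qed

lemma semiring_matrix_semiring:
  fixes R :: "('a, 'b) ring_scheme"
  assumes "Ring.semiring R"
  shows "Ring.semiring (matrix_semiring n R)"
proof -
  interpret Ring.semiring R by fact
  have ent: "A $$ (i, j) \<in> carrier R" if "A \<in> matrices_over n (carrier R)" "i < n" "j < n" for A i j
    using that by (auto simp: matrices_over_def)
  have dims: "dim_row A = n" "dim_col A = n" if "A \<in> matrices_over n (carrier R)" for A
    using that by (auto simp: matrices_over_def)
  have matI: "mat n n f \<in> matrices_over n (carrier R)"
    if "\<And>i j. i < n \<Longrightarrow> j < n \<Longrightarrow> f (i, j) \<in> carrier R" for f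
    using that by (auto simp: matrices_over_def)
  have pick: "(\<Oplus>\<^bsub>R\<^esub>k\<in>{..<n}. if i = k then f k else \<zero>\<^bsub>R\<^esub>) = f i"
    if "i < n" "\<And>k. k < n \<Longrightarrow> f k \<in> carrier R" for i f
    using add.finprod_singleton[of i "{..<n}" f] that by auto
  show ?thesis
  proof (unfold_locales, goal_cases)
    case (8 A B C)
    then have A: "A \<in> matrices_over n (carrier R)" and B: "B \<in> matrices_over n (carrier R)"
      and C: "C \<in> matrices_over n (carrier R)"
      by (simp_all add: matrix_semiring_def)
    have "(\<Oplus>\<^bsub>R\<^esub>k\<in>{..<n}. (\<Oplus>\<^bsub>R\<^esub>l\<in>{..<n}. A $$ (i, l) \<otimes>\<^bsub>R\<^esub> B $$ (l, k)) \<otimes>\<^bsub>R\<^esub> C $$ (k, j))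
        = (\<Oplus>\<^bsub>R\<^esub>l\<in>{..<n}. A $$ (i, l) \<otimes>\<^bsub>R\<^esub> (\<Oplus>\<^bsub>R\<^esub>k\<in>{..<n}. B $$ (l, k) \<otimes>\<^bsub>R\<^esub> C $$ (k, j)))"
      (is "?L = ?R") if "i < n" "j < n" for i j
    proof -
      have "?L = (\<Oplus>\<^bsub>R\<^esub>k\<in>{..<n}. \<Oplus>\<^bsub>R\<^esub>l\<in>{..<n}. A $$ (i, l) \<otimes>\<^bsub>R\<^esub> B $$ (l, k) \<otimes>\<^bsub>R\<^esub> C $$ (k, j))"
        by (intro finsum_cong') (auto simp: finsum_ldistr Pi_def ent[OF A] ent[OF B] ent[OF C] that)
      also have "\<dots> = (\<Oplus>\<^bsub>R\<^esub>l\<in>{..<n}. \<Oplus>\<^bsub>R\<^esub>k\<in>{..<n}. A $$ (i, l) \<otimes>\<^bsub>R\<^esub> B $$ (l, k) \<otimes>\<^bsub>R\<^esub> C $$ (k, j))"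
        by (intro finsum_finsum_swap) (auto simp: ent[OF A] ent[OF B] ent[OF C] that)
      also have "\<dots> = ?R"
        by (intro finsum_cong')
          (auto simp: finsum_rdistr Pi_def ent[OF A] ent[OF B] ent[OF C] that m_assoc
            intro!: finsum_cong')
      finally show ?thesis .
    qed
    then show ?case
      by (auto simp: matrix_semiring_def Pi_def ent[OF A] ent[OF B] ent[OF C]
          intro!: eq_matI cong: finsum_cong)
  next
    case (10 A)
    then have A: "A \<in> matrices_over n (carrier R)" by (simp add: matrix_semiring_def)
    have "(\<Oplus>\<^bsub>R\<^esub>k\<in>{..<n}. (if i = k then \<one>\<^bsub>R\<^esub> else \<zero>\<^bsub>R\<^esub>) \<otimes>\<^bsub>R\<^esub> A $$ (k, j)) = A $$ (i, j)"
      if "i < n" "j < n" for i j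
    proof -
      have "(\<Oplus>\<^bsub>R\<^esub>k\<in>{..<n}. (if i = k then \<one>\<^bsub>R\<^esub> else \<zero>\<^bsub>R\<^esub>) \<otimes>\<^bsub>R\<^esub> A $$ (k, j))
          = (\<Oplus>\<^bsub>R\<^esub>k\<in>{..<n}. if i = k then A $$ (k, j) else \<zero>\<^bsub>R\<^esub>)"
        by (intro finsum_cong') (auto simp: ent[OF A] that)
      then show ?thesis using pick[OF that(1)] ent[OF A] that by auto
    qed
    then show ?case using dims[OF A]
      by (auto simp: matrix_semiring_def Pi_def ent[OF A] intro!: eq_matI cong: finsum_cong)
  next
    case (11 A)
    then have A: "A \<in> matrices_over n (carrier R)" by (simp add: matrix_semiring_def)
    have "(\<Oplus>\<^bsub>R\<^esub>k\<in>{..<n}. A $$ (i, k) \<otimes>\<^bsub>R\<^esub> (if k = j then \<one>\<^bsub>R\<^esub> else \<zero>\<^bsub>R\<^esub>)) = A $$ (i, j)"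
      if "i < n" "j < n" for i j
    proof -
      have "(\<Oplus>\<^bsub>R\<^esub>k\<in>{..<n}. A $$ (i, k) \<otimes>\<^bsub>R\<^esub> (if k = j then \<one>\<^bsub>R\<^esub> else \<zero>\<^bsub>R\<^esub>))
          = (\<Oplus>\<^bsub>R\<^esub>k\<in>{..<n}. if j = k then A $$ (i, k) else \<zero>\<^bsub>R\<^esub>)"
        by (intro finsum_cong') (auto simp: ent[OF A] that)
      then show ?thesis using pick[OF that(2)] ent[OF A] that by auto
    qed
    then show ?case using dims[OF A]
      by (auto simp: matrix_semiring_def Pi_def ent[OF A] intro!: eq_matI cong: finsum_cong)
  qed (auto simp: matrix_semiring_def a_ac l_distr r_distr finsum_addf ent dims Pi_def
      intro!: eq_matI matI finsum_closed cong: finsum_cong)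
qed

lemma brown_mccoy_class_image:
  fixes R :: "('a, 'b) ring_scheme" and S :: "('c, 'd) ring_scheme"
  assumes R: "brown_mccoy_class R" and f: "f \<in> hemiring_hom R S" "f ` carrier R = carrier S"
    and S: "Ring.semiring S" "ideal_simple S"
  shows "carrier S = {\<zero>\<^bsub>S\<^esub>}"
proof (rule ccontr)
  assume nz: "carrier S \<noteq> {\<zero>\<^bsub>S\<^esub>}"
  interpret S: Ring.semiring S by fact
  define g where "g = inv_into (carrier R) f"
  have fg[simp]: "f (g x) = x" if "x \<in> carrier S" for x
    using that f(2) unfolding g_def by (metis f_inv_into_f)
  have fR: "f x \<in> carrier S" if "x \<in> carrier R" for x using that f(2) by auto
  define T :: "'a ring" where
    "T = \<lparr>carrier = g ` carrier S, mult = (\<lambda>x y. g (f x \<otimes>\<^bsub>S\<^esub> f y)), one = g \<one>\<^bsub>S\<^esub>,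
          zero = g \<zero>\<^bsub>S\<^esub>, add = (\<lambda>x y. g (f x \<oplus>\<^bsub>S\<^esub> f y))\<rparr>"
  have 1: "Ring.semiring T"
    by (unfold_locales)
      (auto simp: T_def S.a_ac S.m_assoc S.l_distr S.r_distr)
  have 2: "ideal_simple T"
    unfolding ideal_simple_def
  proof (intro allI impI)
    fix I assume I: "hemiring_ideal T I"
    have sub: "I \<subseteq> g ` carrier S" using I by (simp add: hemiring_ideal_def T_def)
    have gf: "g (f x) = x" if "x \<in> I" for x using that sub by auto
    have "hemiring_ideal S (f ` I)"
      unfolding hemiring_ideal_def
    proof (intro conjI ballI)
      show "f ` I \<subseteq> carrier S" using sub by auto
      have "g \<zero>\<^bsub>S\<^esub> \<in> I" using I by (simp add: hemiring_ideal_def T_def)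
      then show "\<zero>\<^bsub>S\<^esub> \<in> f ` I" by (metis S.zero_closed fg imageI)
    next
      fix x y assume "x \<in> f ` I" "y \<in> f ` I"
      then obtain a b where ab: "a \<in> I" "b \<in> I" "x = f a" "y = f b" by auto
      then have "g (f a \<oplus>\<^bsub>S\<^esub> f b) \<in> I" using I by (simp add: hemiring_ideal_def T_def)
      moreover have "f a \<in> carrier S" "f b \<in> carrier S" using ab sub by auto
      ultimately show "x \<oplus>\<^bsub>S\<^esub> y \<in> f ` I" using ab by (metis S.a_closed fg imageI)
    next
      fix r x assume r: "r \<in> carrier S" and "x \<in> f ` I"
      then obtain a where a: "a \<in> I" "x = f a" by auto
      have c: "f a \<in> carrier S" using a sub by auto
      have "g (r \<otimes>\<^bsub>S\<^esub> f a) \<in> I" "g (f a \<otimes>\<^bsub>S\<^esub> r) \<in> I"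
        using I r a by (force simp: hemiring_ideal_def T_def)+
      then show "r \<otimes>\<^bsub>S\<^esub> x \<in> f ` I" "x \<otimes>\<^bsub>S\<^esub> r \<in> f ` I"
        using a r c by (metis S.m_closed fg imageI)+
    qed
    then have "f ` I = {\<zero>\<^bsub>S\<^esub>} \<or> f ` I = carrier S" using S(2) by (simp add: ideal_simple_def)
    moreover have "I = g ` (f ` I)" using gf by (force simp: image_image)
    ultimately have "I = g ` {\<zero>\<^bsub>S\<^esub>} \<or> I = g ` carrier S" by metis
    then show "I = {\<zero>\<^bsub>T\<^esub>} \<or> I = carrier T" by (simp add: T_def)
  qed
  have 3: "g \<circ> f \<in> hemiring_hom R T"
    using f by (auto simp: hemiring_hom_def T_def fR)
  have 4: "(g \<circ> f) ` carrier R = carrier T"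
    by (simp only: image_comp[symmetric] f(2)) (simp add: T_def)
  have "f ` carrier T = carrier S" by (auto simp: T_def image_image)
  then have 5: "carrier T \<noteq> {\<zero>\<^bsub>T\<^esub>}" using nz by (auto simp: T_def)
  show False using R 1 2 3 4 5 unfolding brown_mccoy_class_def by blast
qed

lemma simple_radical_annihilates:
  fixes R :: "('a, 'b) ring_scheme" and M :: "('a, 'c, 'd) module_scheme"
  assumes M: "simple_semimodule R M"
  shows "simple_radical R \<subseteq> semimodule_annihilator R M"
proof -
  interpret left_semimodule R M using M by (simp add: simple_semimodule_def)
  obtain r0 m0 where m0: "r0 \<in> carrier R" "m0 \<in> carrier M" "r0 \<odot>\<^bsub>M\<^esub> m0 \<noteq> \<zero>\<^bsub>M\<^esub>"
    using M unfolding simple_semimodule_def by blast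
  define f where "f = (\<lambda>r. r \<odot>\<^bsub>M\<^esub> m0)"
  have "subsemimodule R M (f ` carrier R)"
    unfolding subsemimodule_def
  proof (intro conjI ballI)
    show "f ` carrier R \<subseteq> carrier M" using m0 smult_closed by (auto simp: f_def)
    show "\<zero>\<^bsub>M\<^esub> \<in> f ` carrier R" using smult_l_null[OF m0(2)] unfolding f_def
      by (metis R.zero_closed imageI)
  next
    fix x y assume "x \<in> f ` carrier R" "y \<in> f ` carrier R"
    then obtain a b where ab: "a \<in> carrier R" "b \<in> carrier R" "x = f a" "y = f b" by auto
    then have "x \<oplus>\<^bsub>M\<^esub> y = f (a \<oplus>\<^bsub>R\<^esub> b)" using smult_l_distr m0 by (simp add: f_def)
    then show "x \<oplus>\<^bsub>M\<^esub> y \<in> f ` carrier R" using ab by simp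
  next
    fix r x assume "r \<in> carrier R" "x \<in> f ` carrier R"
    then obtain a where a: "a \<in> carrier R" "x = f a" by auto
    with \<open>r \<in> carrier R\<close> have "r \<odot>\<^bsub>M\<^esub> x = f (r \<otimes>\<^bsub>R\<^esub> a)" using smult_assoc m0 by (simp add: f_def)
    then show "r \<odot>\<^bsub>M\<^esub> x \<in> f ` carrier R" using a \<open>r \<in> carrier R\<close> R.m_closed by simp
  qed
  moreover have "f ` carrier R \<noteq> {\<zero>\<^bsub>M\<^esub>}" using m0 by (auto simp: f_def)
  ultimately have fR: "f ` carrier R = carrier M" using M unfolding simple_semimodule_def by blast
  define g where "g = inv_into (carrier R) f"
  have fg[simp]: "f (g x) = x" if "x \<in> carrier M" for x
    using that fR unfolding g_def by (metis f_inv_into_f)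
  define N :: "('a, 'a) module" where
    "N = \<lparr>carrier = g ` carrier M, mult = undefined, one = undefined, zero = g \<zero>\<^bsub>M\<^esub>,
          add = (\<lambda>x y. g (f x \<oplus>\<^bsub>M\<^esub> f y)), smult = (\<lambda>r x. g (r \<odot>\<^bsub>M\<^esub> f x))\<rparr>"
  have 1: "left_semimodule R N"
    by unfold_locales
      (auto simp: N_def M.a_ac smult_closed smult_assoc smult_r_distr smult_l_distr
        smult_r_null smult_l_null)
  have 2: "\<exists>r\<in>carrier R. \<exists>m\<in>carrier N. r \<odot>\<^bsub>N\<^esub> m \<noteq> \<zero>\<^bsub>N\<^esub>"
  proof (intro bexI)
    show "r0 \<odot>\<^bsub>N\<^esub> g m0 \<noteq> \<zero>\<^bsub>N\<^esub>" using m0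
      by (simp add: N_def) (metis M.zero_closed fg smult_closed)
  qed (use m0 in \<open>auto simp: N_def\<close>)
  have 3: "K = {\<zero>\<^bsub>N\<^esub>} \<or> K = carrier N" if K: "subsemimodule R N K" for K
  proof -
    have sub: "K \<subseteq> g ` carrier M" using K by (simp add: subsemimodule_def N_def)
    have gf: "g (f x) = x" if "x \<in> K" for x using that sub by auto
    have "subsemimodule R M (f ` K)"
      unfolding subsemimodule_def
    proof (intro conjI ballI)
      show "f ` K \<subseteq> carrier M" using sub by auto
      have "g \<zero>\<^bsub>M\<^esub> \<in> K" using K by (simp add: subsemimodule_def N_def)
      then show "\<zero>\<^bsub>M\<^esub> \<in> f ` K" by (metis M.zero_closed fg imageI)
    next
      fix x y assume "x \<in> f ` K" "y \<in> f ` K"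
      then obtain a b where ab: "a \<in> K" "b \<in> K" "x = f a" "y = f b" by auto
      then have "g (f a \<oplus>\<^bsub>M\<^esub> f b) \<in> K" using K by (simp add: subsemimodule_def N_def)
      moreover have "f a \<in> carrier M" "f b \<in> carrier M" using ab sub by auto
      ultimately show "x \<oplus>\<^bsub>M\<^esub> y \<in> f ` K" using ab by (metis M.a_closed fg imageI)
    next
      fix r x assume r: "r \<in> carrier R" and "x \<in> f ` K"
      then obtain a where a: "a \<in> K" "x = f a" by auto
      have "g (r \<odot>\<^bsub>M\<^esub> f a) \<in> K" using K r a by (simp add: subsemimodule_def N_def)
      moreover have "f a \<in> carrier M" using a sub by auto
      ultimately show "r \<odot>\<^bsub>M\<^esub> x \<in> f ` K" using a r by (metis smult_closed fg imageI)
    qed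
    then have "f ` K = {\<zero>\<^bsub>M\<^esub>} \<or> f ` K = carrier M" using M by (simp add: simple_semimodule_def)
    moreover have "K = g ` (f ` K)" using gf by (force simp: image_image)
    ultimately have "K = g ` {\<zero>\<^bsub>M\<^esub>} \<or> K = g ` carrier M" by metis
    then show ?thesis by (simp add: N_def)
  qed
  have 4: "C = Id_on (carrier N) \<or> C = carrier N \<times> carrier N"
    if C: "semimodule_congruence R N C" for C
  proof -
    define D where "D = {(x, y). x \<in> carrier M \<and> y \<in> carrier M \<and> (g x, g y) \<in> C}"
    have eq: "equiv (g ` carrier M) C" using C by (simp add: semimodule_congruence_def N_def)
    have sub: "C \<subseteq> g ` carrier M \<times> g ` carrier M" and rf: "refl_on (g ` carrier M) C"
      using eq by (auto simp: equiv_def)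
    have sy: "sym C" and tr: "trans C" using eq by (auto simp: equiv_def)
    have "semimodule_congruence R M D"
      unfolding semimodule_congruence_def
    proof (intro conjI allI impI ballI)
      show "equiv (carrier M) D"
      proof (rule equivI)
        show "D \<subseteq> carrier M \<times> carrier M" by (auto simp: D_def)
        show "refl_on (carrier M) D" using rf by (auto simp: D_def refl_on_def)
        show "sym D" using sy by (auto simp: D_def sym_def)
        show "trans D" using tr unfolding D_def trans_def by blast
      qed
    next
      fix x x' y y' assume "(x, x') \<in> D" "(y, y') \<in> D"
      then show "(x \<oplus>\<^bsub>M\<^esub> y, x' \<oplus>\<^bsub>M\<^esub> y') \<in> D"
        using C by (fastforce simp: D_def semimodule_congruence_def N_def)
    next
      fix r x x' assume "r \<in> carrier R" "(x, x') \<in> D"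
      then show "(r \<odot>\<^bsub>M\<^esub> x, r \<odot>\<^bsub>M\<^esub> x') \<in> D"
        using C by (fastforce simp: D_def semimodule_congruence_def N_def smult_closed)
    qed
    then have "D = Id_on (carrier M) \<or> D = carrier M \<times> carrier M"
      using M by (simp add: simple_semimodule_def)
    moreover have "C = map_prod g g ` D"
      using sub by (force simp: D_def)
    moreover have "map_prod g g ` Id_on (carrier M) = Id_on (g ` carrier M)"
      by (force simp: Id_on_def)
    moreover have "map_prod g g ` (carrier M \<times> carrier M) = g ` carrier M \<times> g ` carrier M"
      by force
    ultimately show ?thesis by (auto simp: N_def)
  qed
  have "simple_semimodule R N" unfolding simple_semimodule_def using 1 2 3 4 by blast
  moreover have "semimodule_annihilator R N \<subseteq> semimodule_annihilator R M"
  proof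
    fix r assume "r \<in> semimodule_annihilator R N"
    then have r: "r \<in> carrier R" and *: "\<And>m. m \<in> carrier M \<Longrightarrow> g (r \<odot>\<^bsub>M\<^esub> m) = g \<zero>\<^bsub>M\<^esub>"
      by (auto simp: semimodule_annihilator_def N_def)
    have "r \<odot>\<^bsub>M\<^esub> m = \<zero>\<^bsub>M\<^esub>" if "m \<in> carrier M" for m
      using *[OF that] by (metis M.zero_closed fg r smult_closed that)
    then show "r \<in> semimodule_annihilator R M" using r by (simp add: semimodule_annihilator_def)
  qed
  ultimately show ?thesis unfolding simple_radical_def by blast
qed

end

theory Submission
  imports Defs
begin

text \<open>
  The semiring \<open>R\<close> has an identity, so every ideal of the matrix semiring consists of all matrices over
  one ideal of \<open>R\<close> (\<open>ideal_entries\<close>, \<open>ideal_eq_matrices_over\<close>). All three radicals of a semiring are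
  two-sided ideals. Hence for each of them it suffices to show that \<open>r\<close> belongs to the radical of \<open>R\<close>
  if and only if the matrix with \<open>r\<close> at position \<open>(0, 0)\<close> and zeros elsewhere belongs to the radical of
  the matrix semiring.

  The Brown-McCoy radical is the intersection of the kernels of all homomorphisms onto ideal-simple
  semirings (\<open>brown_mccoy_radical_eq\<close>), since a homomorphism from an ideal onto a semiring with
  identity extends to the whole hemiring (\<open>hom_extends_from_ideal\<close>). Ideal-simple images of \<open>R\<close> and of
  the matrix semiring correspond to each other: matrices over an ideal-simple semiring form an
  ideal-simple semiring, and the corner of an ideal-simple image of the matrices is an ideal-simple
  image of \<open>R\<close>.

  For simple semimodules the correspondence sends a simple semimodule over \<open>R\<close> to its column vectors
  (\<open>simple_Col\<close>), and a simple semimodule over the matrices to its corner (\<open>simple_Corner\<close>).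
  Annihilators match under both constructions.

  The Jacobson-Bourne radical is handled through right semiregular right ideals instead of
  irreducible semimodules. Computing with pairs as formal differences, one shows that sums and left
  multiples of such right ideals are again right semiregular. So their union is the radical, which is
  two-sided and right semiregular itself (\<open>right_semiregular_jacobson_radical\<close>). One direction of the
  comparison takes corner entries of quasi-inverses, the other one computes quasi-inverses in the
  right ideal of matrices supported in the first row.
\<close>

section \<open>Matrices with a single entry and the ideals of a matrix semiring\<close>

lemma (in abelian_monoid) finsum_single_term:
  assumes "finite X" "i \<in> X" "f i \<in> carrier G" "\<And>k. k \<in> X \<Longrightarrow> k \<noteq> i \<Longrightarrow> f k = \<zero>"
  shows "finsum G f X = f i"
proof -
  have "finsum G f X = finsum G (\<lambda>k. if i = k then f k else \<zero>) X"
    using assms by (intro finsum_cong') auto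
  also have "\<dots> = f i"
    using assms by (intro finsum_singleton) (auto intro: Pi_I, metis zero_closed)
  finally show ?thesis .
qed

locale square_matrices = Ring.semiring R for R :: "('a, 'b) ring_scheme" (structure) +
  fixes n :: nat
  assumes dim_pos: "0 < n"
begin

abbreviation Mat :: "'a mat ring" where "Mat \<equiv> matrix_semiring n R"

sublocale mat: Ring.semiring Mat
  by (rule semiring_matrix_semiring) (rule semiring_axioms)

lemma carrier_Mat: "carrier Mat = matrices_over n (carrier R)"
  by (simp add: matrix_semiring_def)

lemma entry_closed: "A \<in> carrier Mat \<Longrightarrow> i < n \<Longrightarrow> j < n \<Longrightarrow> A $$ (i, j) \<in> carrier R"
  by (auto simp: carrier_Mat matrices_over_def)

lemma dim_Mat: "A \<in> carrier Mat \<Longrightarrow> dim_row A = n" "A \<in> carrier Mat \<Longrightarrow> dim_col A = n"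
  by (auto simp: carrier_Mat matrices_over_def)

lemma mat_in_matrices_over:
  "(\<And>i j. i < n \<Longrightarrow> j < n \<Longrightarrow> f (i, j) \<in> X) \<Longrightarrow> mat n n f \<in> matrices_over n X"
  by (auto simp: matrices_over_def)

lemma mat_in_carrier:
  "(\<And>i j. i < n \<Longrightarrow> j < n \<Longrightarrow> f (i, j) \<in> carrier R) \<Longrightarrow> mat n n f \<in> carrier Mat"
  by (simp add: carrier_Mat mat_in_matrices_over)

lemma Mat_eqI:
  assumes "A \<in> carrier Mat" "B \<in> carrier Mat"
    and "\<And>i j. i < n \<Longrightarrow> j < n \<Longrightarrow> A $$ (i, j) = B $$ (i, j)"
  shows "A = B"
  using assms by (intro eq_matI) (auto simp: dim_Mat)

lemma zero_entry: "i < n \<Longrightarrow> j < n \<Longrightarrow> \<zero>\<^bsub>Mat\<^esub> $$ (i, j) = \<zero>"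
  by (simp add: matrix_semiring_def)

lemma add_entry:
  "i < n \<Longrightarrow> j < n \<Longrightarrow> (A \<oplus>\<^bsub>Mat\<^esub> B) $$ (i, j) = A $$ (i, j) \<oplus> B $$ (i, j)"
  by (simp add: matrix_semiring_def)

lemma mult_entry:
  "i < n \<Longrightarrow> j < n \<Longrightarrow>
     (A \<otimes>\<^bsub>Mat\<^esub> B) $$ (i, j) = (\<Oplus>k\<in>{..<n}. A $$ (i, k) \<otimes> B $$ (k, j))"
  by (simp add: matrix_semiring_def)

definition entry_mat :: "nat \<Rightarrow> nat \<Rightarrow> 'a \<Rightarrow> 'a mat" where
  "entry_mat i j r = mat n n (\<lambda>(k, l). if k = i \<and> l = j then r else \<zero>)"

lemma entry_mat_entry:
  "k < n \<Longrightarrow> l < n \<Longrightarrow> entry_mat i j r $$ (k, l) = (if k = i \<and> l = j then r else \<zero>)"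
  by (simp add: entry_mat_def)

lemma entry_mat_closed [simp]: "r \<in> carrier R \<Longrightarrow> entry_mat i j r \<in> carrier Mat"
  unfolding entry_mat_def by (intro mat_in_carrier) auto

lemma entry_mat_zero [simp]: "entry_mat i j \<zero> = \<zero>\<^bsub>Mat\<^esub>"
  by (rule Mat_eqI) (auto simp: entry_mat_entry zero_entry)

lemma entry_mat_add:
  "\<lbrakk>r \<in> carrier R; s \<in> carrier R\<rbrakk> \<Longrightarrow>
     entry_mat i j r \<oplus>\<^bsub>Mat\<^esub> entry_mat i j s = entry_mat i j (r \<oplus> s)"
  by (rule Mat_eqI) (auto simp: entry_mat_entry add_entry)

lemma entry_mat_mult_entry:
  assumes "r \<in> carrier R" "A \<in> carrier Mat" "j < n" "k < n" "l < n"
  shows "(entry_mat i j r \<otimes>\<^bsub>Mat\<^esub> A) $$ (k, l) = (if k = i then r \<otimes> A $$ (j, l) else \<zero>)"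
proof -
  have "(entry_mat i j r \<otimes>\<^bsub>Mat\<^esub> A) $$ (k, l) =
      (\<Oplus>m\<in>{..<n}. entry_mat i j r $$ (k, m) \<otimes> A $$ (m, l))"
    using assms by (simp add: mult_entry)
  also have "\<dots> = entry_mat i j r $$ (k, j) \<otimes> A $$ (j, l)"
    using assms by (intro finsum_single_term) (auto simp: entry_mat_entry entry_closed)
  finally show ?thesis using assms by (simp add: entry_mat_entry entry_closed)
qed

lemma mult_entry_mat_entry:
  assumes "r \<in> carrier R" "A \<in> carrier Mat" "i < n" "k < n" "l < n"
  shows "(A \<otimes>\<^bsub>Mat\<^esub> entry_mat i j r) $$ (k, l) = (if l = j then A $$ (k, i) \<otimes> r else \<zero>)"
proof -
  have "(A \<otimes>\<^bsub>Mat\<^esub> entry_mat i j r) $$ (k, l) =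
      (\<Oplus>m\<in>{..<n}. A $$ (k, m) \<otimes> entry_mat i j r $$ (m, l))"
    using assms by (simp add: mult_entry)
  also have "\<dots> = A $$ (k, i) \<otimes> entry_mat i j r $$ (i, l)"
    using assms by (intro finsum_single_term) (auto simp: entry_mat_entry entry_closed)
  finally show ?thesis using assms by (simp add: entry_mat_entry entry_closed)
qed

lemma entry_mat_sandwich:
  assumes "r \<in> carrier R" "s \<in> carrier R" "A \<in> carrier Mat" "i < n" "j < n"
  shows "entry_mat k i r \<otimes>\<^bsub>Mat\<^esub> A \<otimes>\<^bsub>Mat\<^esub> entry_mat j l s
    = entry_mat k l (r \<otimes> A $$ (i, j) \<otimes> s)"
  using assms
  by (intro Mat_eqI)
    (auto simp: mult_entry_mat_entry entry_mat_mult_entry entry_mat_entry entry_closed)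

lemma entry_mat_mult:
  assumes "r \<in> carrier R" "s \<in> carrier R" "j < n"
  shows "entry_mat i j r \<otimes>\<^bsub>Mat\<^esub> entry_mat j k s = entry_mat i k (r \<otimes> s)"
  using assms
  by (intro Mat_eqI) (auto simp: entry_mat_mult_entry entry_mat_entry entry_closed)

text \<open>
  Multiplying on both sides by matrix units moves the entry \<open>(i, j)\<close> to the corner and deletes all
  others; conversely matrix units move it back, and \<open>A\<close> is the sum of its single-entry parts.
\<close>

lemma ideal_entries:
  assumes J: "hemiring_ideal Mat J" and A: "A \<in> carrier Mat"
  shows "A \<in> J \<longleftrightarrow> (\<forall>i<n. \<forall>j<n. entry_mat 0 0 (A $$ (i, j)) \<in> J)"
proof
  assume "A \<in> J"
  show "\<forall>i<n. \<forall>j<n. entry_mat 0 0 (A $$ (i, j)) \<in> J"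
  proof (intro allI impI)
    fix i j assume ij: "i < n" "j < n"
    have "entry_mat 0 i \<one> \<otimes>\<^bsub>Mat\<^esub> A \<otimes>\<^bsub>Mat\<^esub> entry_mat j 0 \<one> \<in> J"
      using J \<open>A \<in> J\<close> by (auto simp: hemiring_ideal_def)
    then show "entry_mat 0 0 (A $$ (i, j)) \<in> J"
      using ij A by (simp add: entry_mat_sandwich entry_closed)
  qed
next
  assume entries: "\<forall>i<n. \<forall>j<n. entry_mat 0 0 (A $$ (i, j)) \<in> J"
  have single: "entry_mat i j (A $$ (i, j)) \<in> J" if "i < n" "j < n" for i j
  proof -
    have "entry_mat i 0 \<one> \<otimes>\<^bsub>Mat\<^esub> entry_mat 0 0 (A $$ (i, j)) \<otimes>\<^bsub>Mat\<^esub> entry_mat 0 j \<one> \<in> J"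
      using J entries that by (auto simp: hemiring_ideal_def)
    then show ?thesis
      using that A dim_pos by (simp add: entry_mat_sandwich entry_closed entry_mat_entry)
  qed
  \<comment> \<open>Rebuild \<open>A\<close> one entry at a time.\<close>
  have "mat n n (\<lambda>p. if p \<in> X then A $$ p else \<zero>) \<in> J"
    if "finite X" "X \<subseteq> {..<n} \<times> {..<n}" for X
    using that
  proof (induction X rule: finite_induct)
    case empty
    have "mat n n (\<lambda>p. if p \<in> {} then A $$ p else \<zero>) = \<zero>\<^bsub>Mat\<^esub>"
      by (rule Mat_eqI) (auto simp: zero_entry intro!: mat_in_carrier)
    then show ?case using J by (simp add: hemiring_ideal_def)
  next
    case (insert p X)
    obtain i j where p: "p = (i, j)" by force
    have ij: "i < n" "j < n" using insert.prems p by auto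
    let ?X = "\<lambda>X. mat n n (\<lambda>p. if p \<in> X then A $$ p else \<zero>)"
    have "?X (insert p X) = entry_mat i j (A $$ (i, j)) \<oplus>\<^bsub>Mat\<^esub> ?X X"
      using insert.hyps ij A p
      by (intro Mat_eqI)
        (auto simp: add_entry entry_mat_entry entry_closed intro!: mat_in_carrier)
    then show ?case
      using J insert.IH insert.prems single[OF ij] by (simp add: hemiring_ideal_def)
  qed
  from this[of "{..<n} \<times> {..<n}"]
  have "mat n n (\<lambda>p. if p \<in> {..<n} \<times> {..<n} then A $$ p else \<zero>) \<in> J" by simp
  moreover have "mat n n (\<lambda>p. if p \<in> {..<n} \<times> {..<n} then A $$ p else \<zero>) = A"
    using A by (intro Mat_eqI) (auto simp: entry_closed intro!: mat_in_carrier)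
  ultimately show "A \<in> J" by simp
qed

text \<open>
  The form in which each radical is treated: once a radical of the matrix semiring is known to be an
  ideal, only matrices supported in the corner have to be compared.
\<close>

lemma ideal_eq_matrices_over:
  assumes J: "hemiring_ideal Mat J"
    and L: "L \<subseteq> carrier R" "\<And>r. r \<in> carrier R \<Longrightarrow> entry_mat 0 0 r \<in> J \<longleftrightarrow> r \<in> L"
  shows "J = matrices_over n L"
proof -
  have "A \<in> J \<longleftrightarrow> A \<in> matrices_over n L" if A: "A \<in> carrier Mat" for A
    using ideal_entries[OF J A] L(2) entry_closed[OF A] A
    by (auto simp: carrier_Mat matrices_over_def)
  moreover have "J \<subseteq> carrier Mat" using J by (simp add: hemiring_ideal_def)
  moreover have "matrices_over n L \<subseteq> carrier Mat"
    using L(1) by (auto simp: carrier_Mat matrices_over_def)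
  ultimately show ?thesis by blast
qed

lemma corner_ideal:
  assumes J: "hemiring_ideal Mat J"
  shows "hemiring_ideal R {r \<in> carrier R. entry_mat 0 0 r \<in> J}"
  unfolding hemiring_ideal_def
proof (intro conjI ballI)
  show "\<zero> \<in> {r \<in> carrier R. entry_mat 0 0 r \<in> J}"
    using J by (simp add: hemiring_ideal_def)
next
  fix x y assume "x \<in> {r \<in> carrier R. entry_mat 0 0 r \<in> J}" "y \<in> {r \<in> carrier R. entry_mat 0 0 r \<in> J}"
  then show "x \<oplus> y \<in> {r \<in> carrier R. entry_mat 0 0 r \<in> J}"
    using J by (auto simp: hemiring_ideal_def simp flip: entry_mat_add)
next
  fix r x assume *: "r \<in> carrier R" "x \<in> {r \<in> carrier R. entry_mat 0 0 r \<in> J}"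
  then show "r \<otimes> x \<in> {r \<in> carrier R. entry_mat 0 0 r \<in> J}"
    "x \<otimes> r \<in> {r \<in> carrier R. entry_mat 0 0 r \<in> J}"
    using J dim_pos by (auto simp: hemiring_ideal_def simp flip: entry_mat_mult[where j=0])
qed auto

lemma matrices_over_ideal:
  assumes L: "hemiring_ideal R L"
  shows "hemiring_ideal Mat (matrices_over n L)"
proof -
  have sums: "finsum R f X \<in> L" if "finite X" "\<And>k. k \<in> X \<Longrightarrow> f k \<in> L" for f :: "nat \<Rightarrow> 'a" and X
    using that
  proof (induction X rule: finite_induct)
    case (insert k X)
    then have "f \<in> X \<rightarrow> carrier R" "f k \<in> carrier R" using L by (auto simp: hemiring_ideal_def)
    then show ?case using L insert by (auto simp: hemiring_ideal_def)
  qed (use L in \<open>simp add: hemiring_ideal_def\<close>)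
  have sub: "matrices_over n L \<subseteq> carrier Mat"
    using L by (auto simp: carrier_Mat matrices_over_def hemiring_ideal_def)
  have ent: "A \<in> matrices_over n L \<longleftrightarrow> (\<forall>i<n. \<forall>j<n. A $$ (i, j) \<in> L)"
    if "A \<in> carrier Mat" for A
    using that by (auto simp: carrier_Mat matrices_over_def)
  show ?thesis
    unfolding hemiring_ideal_def
  proof (intro conjI ballI)
    show "\<zero>\<^bsub>Mat\<^esub> \<in> matrices_over n L"
      using L by (simp add: ent zero_entry hemiring_ideal_def)
  next
    fix x y assume "x \<in> matrices_over n L" "y \<in> matrices_over n L"
    moreover from this have "x \<in> carrier Mat" "y \<in> carrier Mat" using sub by auto
    ultimately show "x \<oplus>\<^bsub>Mat\<^esub> y \<in> matrices_over n L"
      using L by (simp add: ent add_entry hemiring_ideal_def)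
  next
    fix r x assume r: "r \<in> carrier Mat" and x: "x \<in> matrices_over n L"
    moreover from this have "x \<in> carrier Mat" using sub by auto
    ultimately show "r \<otimes>\<^bsub>Mat\<^esub> x \<in> matrices_over n L" "x \<otimes>\<^bsub>Mat\<^esub> r \<in> matrices_over n L"
      using L by (auto simp: ent mult_entry entry_closed hemiring_ideal_def intro!: sums)
  qed (use sub in auto)
qed

end

section \<open>The Brown-McCoy radical\<close>

lemma hom_image_ideal:
  assumes f: "f \<in> hemiring_hom R S" "f ` carrier R = carrier S" and I: "hemiring_ideal R I"
  shows "hemiring_ideal S (f ` I)"
proof -
  have sub: "I \<subseteq> carrier R" using I by (simp add: hemiring_ideal_def)
  show ?thesis
    unfolding hemiring_ideal_def
  proof (intro conjI ballI)
    show "f ` I \<subseteq> carrier S" using f(2) sub by auto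
    have "f \<zero>\<^bsub>R\<^esub> = \<zero>\<^bsub>S\<^esub>" "\<zero>\<^bsub>R\<^esub> \<in> I"
      using f(1) I by (simp_all add: hemiring_hom_def hemiring_ideal_def)
    then show "\<zero>\<^bsub>S\<^esub> \<in> f ` I" by (metis imageI)
  next
    fix x y assume "x \<in> f ` I" "y \<in> f ` I"
    then obtain a b where ab: "a \<in> I" "b \<in> I" "x = f a" "y = f b" by auto
    then have "a \<in> carrier R" "b \<in> carrier R" using sub by auto
    then have "x \<oplus>\<^bsub>S\<^esub> y = f (a \<oplus>\<^bsub>R\<^esub> b)" using f(1) ab by (simp add: hemiring_hom_def)
    then show "x \<oplus>\<^bsub>S\<^esub> y \<in> f ` I" using ab I by (auto simp: hemiring_ideal_def)
  next
    fix r x assume "r \<in> carrier S" "x \<in> f ` I"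
    then obtain a b where ab: "a \<in> I" "b \<in> carrier R" "x = f a" "r = f b"
      using f(2) by blast
    moreover from this have "a \<in> carrier R" using sub by auto
    ultimately have "r \<otimes>\<^bsub>S\<^esub> x = f (b \<otimes>\<^bsub>R\<^esub> a)" "x \<otimes>\<^bsub>S\<^esub> r = f (a \<otimes>\<^bsub>R\<^esub> b)"
      using f(1) by (simp_all add: hemiring_hom_def)
    then show "r \<otimes>\<^bsub>S\<^esub> x \<in> f ` I" "x \<otimes>\<^bsub>S\<^esub> r \<in> f ` I"
      using ab I by (auto simp: hemiring_ideal_def)
  qed
qed

lemma hemiring_restrict_ideal:
  assumes "hemiring R" and I: "hemiring_ideal R I"
  shows "hemiring (R\<lparr>carrier := I\<rparr>)"
proof -
  interpret hemiring R by fact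
  have "x \<in> carrier R" if "x \<in> I" for x using that I by (auto simp: hemiring_ideal_def)
  then show ?thesis
    using I
    by unfold_locales
      (auto simp: hemiring_ideal_def a_ac m_assoc l_distr r_distr l_null r_null)
qed

text \<open>
  An ideal has no identity in general, but a preimage \<open>e\<close> of the identity of \<open>S\<close> serves as one up to
  \<open>f\<close>. The extension is \<open>r \<mapsto> f (r e)\<close>. It is multiplicative because \<open>f (r e) = f (e r e) = f (e r)\<close>,
  so that the two sides of \<open>e\<close> are interchangeable.
\<close>

lemma hom_extends_from_ideal:
  assumes R: "hemiring R" and I: "hemiring_ideal R I"
    and f: "f \<in> hemiring_hom (R\<lparr>carrier := I\<rparr>) S" "f ` I = carrier S"
    and S: "Ring.semiring S"
  shows "\<exists>F\<in>hemiring_hom R S. F ` carrier R = carrier S \<and> (\<forall>x\<in>I. F x = f x)"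
proof -
  interpret R: hemiring R by fact
  interpret S: Ring.semiring S by fact
  have sub: "x \<in> carrier R" if "x \<in> I" for x using that I by (auto simp: hemiring_ideal_def)
  have cl: "r \<otimes>\<^bsub>R\<^esub> x \<in> I" "x \<otimes>\<^bsub>R\<^esub> r \<in> I" if "x \<in> I" "r \<in> carrier R" for x r
    using that I by (auto simp: hemiring_ideal_def)
  have fS: "f x \<in> carrier S" if "x \<in> I" for x using that f(2) by auto
  have f_add: "f (x \<oplus>\<^bsub>R\<^esub> y) = f x \<oplus>\<^bsub>S\<^esub> f y" and f_mult: "f (x \<otimes>\<^bsub>R\<^esub> y) = f x \<otimes>\<^bsub>S\<^esub> f y"
    if "x \<in> I" "y \<in> I" for x y
    using that f(1) by (auto simp: hemiring_hom_def)
  have f_zero: "f \<zero>\<^bsub>R\<^esub> = \<zero>\<^bsub>S\<^esub>" using f(1) by (auto simp: hemiring_hom_def)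
  obtain e where e: "e \<in> I" "f e = \<one>\<^bsub>S\<^esub>" using f(2) by (metis S.one_closed imageE)
  define F where "F r = f (r \<otimes>\<^bsub>R\<^esub> e)" for r
  have F_left: "F r = f (e \<otimes>\<^bsub>R\<^esub> r)" if r: "r \<in> carrier R" for r
  proof -
    have "f (e \<otimes>\<^bsub>R\<^esub> r) = f (e \<otimes>\<^bsub>R\<^esub> r \<otimes>\<^bsub>R\<^esub> e)"
      using e r cl fS by (simp add: f_mult)
    also have "\<dots> = f (e \<otimes>\<^bsub>R\<^esub> (r \<otimes>\<^bsub>R\<^esub> e))" using e r sub by (simp add: R.m_assoc)
    also have "\<dots> = F r" unfolding F_def using e r cl fS by (simp add: f_mult)
    finally show ?thesis ..
  qed
  have F_mult: "F (r \<otimes>\<^bsub>R\<^esub> s) = F r \<otimes>\<^bsub>S\<^esub> F s" if rs: "r \<in> carrier R" "s \<in> carrier R" for r s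
  proof -
    have "F r \<otimes>\<^bsub>S\<^esub> F s = f (e \<otimes>\<^bsub>R\<^esub> r \<otimes>\<^bsub>R\<^esub> (s \<otimes>\<^bsub>R\<^esub> e))"
      using rs e cl by (simp add: F_left[OF rs(1)] F_def[of s] f_mult)
    also have "\<dots> = f (e \<otimes>\<^bsub>R\<^esub> (r \<otimes>\<^bsub>R\<^esub> s \<otimes>\<^bsub>R\<^esub> e))"
      using rs e sub by (simp add: R.m_assoc R.m_closed)
    also have "\<dots> = F (r \<otimes>\<^bsub>R\<^esub> s)"
      unfolding F_def using rs e cl fS by (simp add: f_mult R.m_closed)
    finally show ?thesis ..
  qed
  have F_I: "F x = f x" if "x \<in> I" for x
    using that e fS by (simp add: F_def f_mult)
  have "F \<in> hemiring_hom R S"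
    unfolding hemiring_hom_def
  proof (intro CollectI conjI ballI)
    show "F \<in> carrier R \<rightarrow> carrier S" unfolding F_def using cl e fS by auto
    show "F \<zero>\<^bsub>R\<^esub> = \<zero>\<^bsub>S\<^esub>" unfolding F_def using sub[OF e(1)] by (simp add: R.l_null f_zero)
  next
    fix x y assume xy: "x \<in> carrier R" "y \<in> carrier R"
    show "F (x \<oplus>\<^bsub>R\<^esub> y) = F x \<oplus>\<^bsub>S\<^esub> F y"
      unfolding F_def using xy cl e sub by (simp add: R.l_distr f_add)
    show "F (x \<otimes>\<^bsub>R\<^esub> y) = F x \<otimes>\<^bsub>S\<^esub> F y" using xy by (rule F_mult)
  qed
  moreover have "F ` carrier R = carrier S"
  proof
    show "F ` carrier R \<subseteq> carrier S" unfolding F_def using cl e fS by auto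
    have "F ` I = carrier S" using F_I f(2) by simp
    then show "carrier S \<subseteq> F ` carrier R" using sub by blast
  qed
  ultimately show ?thesis using F_I by (intro bexI[of _ F] conjI ballI)
qed

text \<open>
  The image of an ideal in an ideal-simple semiring \<open>S\<close> is zero or all of \<open>S\<close>, and an ideal of the
  Brown-McCoy class cannot have \<open>S\<close> as its image unless \<open>S\<close> is zero. The element type of \<open>S\<close> is
  arbitrary here, which lets matrix semirings and corners occur as images below.
\<close>

lemma brown_mccoy_radical_vanishes:
  fixes R :: "('a, 'b) ring_scheme" and S :: "('c, 'd) ring_scheme"
  assumes r: "r \<in> brown_mccoy_radical R"
    and F: "F \<in> hemiring_hom R S" "F ` carrier R = carrier S"
    and S: "Ring.semiring S" "ideal_simple S"
  shows "F r = \<zero>\<^bsub>S\<^esub>"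
proof -
  obtain I where I: "r \<in> I" "hemiring_ideal R I" "brown_mccoy_class (R\<lparr>carrier := I\<rparr>)"
    using r by (auto simp: brown_mccoy_radical_def)
  have sub: "I \<subseteq> carrier R" using I(2) by (simp add: hemiring_ideal_def)
  have "F ` I = {\<zero>\<^bsub>S\<^esub>} \<or> F ` I = carrier S"
    using hom_image_ideal[OF F I(2)] S(2) by (auto simp: ideal_simple_def)
  then show ?thesis
  proof
    assume "F ` I = carrier S"
    moreover have "F \<in> hemiring_hom (R\<lparr>carrier := I\<rparr>) S"
      using F sub unfolding hemiring_hom_def by fastforce
    ultimately have "carrier S = {\<zero>\<^bsub>S\<^esub>}"
      using brown_mccoy_class_image[OF I(3)] S by simp
    then show ?thesis using F(2) I(1) sub by auto
  qed (use I(1) in auto)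
qed

text \<open>
  The radical is the intersection of the kernels of the homomorphisms onto ideal-simple semirings.
  That intersection \<open>B\<close> belongs to the class itself: a homomorphism from \<open>B\<close> onto an ideal-simple
  semiring extends to the whole hemiring by \<open>hom_extends_from_ideal\<close>, hence vanishes on \<open>B\<close>.
\<close>

lemma brown_mccoy_radical_eq:
  fixes R :: "('a, 'b) ring_scheme"
  assumes R: "hemiring R"
  shows "brown_mccoy_radical R =
    {r \<in> carrier R. \<forall>(S :: 'a ring) F. F \<in> hemiring_hom R S \<longrightarrow> F ` carrier R = carrier S \<longrightarrow>
       Ring.semiring S \<longrightarrow> ideal_simple S \<longrightarrow> F r = \<zero>\<^bsub>S\<^esub>}"
    and "hemiring_ideal R (brown_mccoy_radical R)"
proof -
  interpret hemiring R by fact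
  define onto_simple where "onto_simple F S \<longleftrightarrow> F \<in> hemiring_hom R S \<and> F ` carrier R = carrier S \<and>
    Ring.semiring S \<and> ideal_simple S" for F and S :: "'a ring"
  define B where "B = {r \<in> carrier R. \<forall>(S :: 'a ring) F. onto_simple F S \<longrightarrow> F r = \<zero>\<^bsub>S\<^esub>}"
  have hom: "F \<zero>\<^bsub>R\<^esub> = \<zero>\<^bsub>S\<^esub>"
    "\<And>x y. x \<in> carrier R \<Longrightarrow> y \<in> carrier R \<Longrightarrow> F (x \<oplus>\<^bsub>R\<^esub> y) = F x \<oplus>\<^bsub>S\<^esub> F y"
    "\<And>x y. x \<in> carrier R \<Longrightarrow> y \<in> carrier R \<Longrightarrow> F (x \<otimes>\<^bsub>R\<^esub> y) = F x \<otimes>\<^bsub>S\<^esub> F y"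
    "\<And>x. x \<in> carrier R \<Longrightarrow> F x \<in> carrier S" "Ring.semiring S"
    if "onto_simple F S" for F and S :: "'a ring"
    using that by (auto simp: onto_simple_def hemiring_hom_def)
  have kernel: "F x = \<zero>\<^bsub>S\<^esub>" if "x \<in> B" "onto_simple F S" for x F and S :: "'a ring"
    using that by (simp add: B_def)
  have B_carrier: "x \<in> carrier R" if "x \<in> B" for x using that by (simp add: B_def)
  have B_I: "x \<in> B"
    if "x \<in> carrier R" "\<And>F S. onto_simple F S \<Longrightarrow> F x = \<zero>\<^bsub>S\<^esub>" for x
    using that by (simp add: B_def)
  have B: "hemiring_ideal R B"
    unfolding hemiring_ideal_def
  proof (intro conjI ballI)
    show "\<zero>\<^bsub>R\<^esub> \<in> B" by (intro B_I zero_closed hom(1))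
  next
    fix x y assume xy: "x \<in> B" "y \<in> B"
    show "x \<oplus>\<^bsub>R\<^esub> y \<in> B"
    proof (rule B_I)
      fix F and S :: "'a ring" assume FS: "onto_simple F S"
      interpret S: Ring.semiring S using FS by (rule hom)
      show "F (x \<oplus>\<^bsub>R\<^esub> y) = \<zero>\<^bsub>S\<^esub>" 
        using xy by (simp add: hom[OF FS] B_carrier kernel[OF _ FS])
    qed (use xy in \<open>simp add: B_carrier\<close>)
  next
    fix r x assume rx: "r \<in> carrier R" "x \<in> B"
    have vanish: "F (r \<otimes>\<^bsub>R\<^esub> x) = \<zero>\<^bsub>S\<^esub> \<and> F (x \<otimes>\<^bsub>R\<^esub> r) = \<zero>\<^bsub>S\<^esub>"
      if FS: "onto_simple F S" for F and S :: "'a ring"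
    proof -
      interpret S: Ring.semiring S using FS by (rule hom)
      show ?thesis using rx by (simp add: hom[OF FS] B_carrier kernel[OF _ FS])
    qed
    show "r \<otimes>\<^bsub>R\<^esub> x \<in> B"
      by (rule B_I, simp add: rx B_carrier m_closed, rule vanish[THEN conjunct1])
    show "x \<otimes>\<^bsub>R\<^esub> r \<in> B"
      by (rule B_I, simp add: rx B_carrier m_closed, rule vanish[THEN conjunct2])
  qed (simp add: B_carrier subsetI)
  have "brown_mccoy_class (R\<lparr>carrier := B\<rparr>)"
    unfolding brown_mccoy_class_def
  proof (intro conjI notI)
    show "hemiring (R\<lparr>carrier := B\<rparr>)" using R B by (rule hemiring_restrict_ideal)
  next
    assume "\<exists>(S :: 'a ring) f. f \<in> hemiring_hom (R\<lparr>carrier := B\<rparr>) S \<and>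
      f ` carrier (R\<lparr>carrier := B\<rparr>) = carrier S \<and> carrier S \<noteq> {\<zero>\<^bsub>S\<^esub>} \<and>
      Ring.semiring S \<and> ideal_simple S"
    then obtain S :: "'a ring" and f where f: "f \<in> hemiring_hom (R\<lparr>carrier := B\<rparr>) S"
      "f ` B = carrier S" and S: "carrier S \<noteq> {\<zero>\<^bsub>S\<^esub>}" "Ring.semiring S" "ideal_simple S"
      by auto
    obtain F where F: "F \<in> hemiring_hom R S" "F ` carrier R = carrier S" "\<And>x. x \<in> B \<Longrightarrow> F x = f x"
      using hom_extends_from_ideal[OF R B _ _ S(2), of f] f by auto
    have FS: "onto_simple F S" using F S by (simp add: onto_simple_def)
    have "f x = \<zero>\<^bsub>S\<^esub>" if "x \<in> B" for x
      using kernel[OF that FS] F(3)[OF that] by simp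
    then have "f ` B \<subseteq> {\<zero>\<^bsub>S\<^esub>}" by blast
    moreover have "\<zero>\<^bsub>S\<^esub> \<in> carrier S"
      using hom(4)[OF FS zero_closed] unfolding hom(1)[OF FS] .
    ultimately show False using f(2) S(1) by auto
  qed
  then have "B \<subseteq> brown_mccoy_radical R"
    using B unfolding brown_mccoy_radical_def by blast
  moreover have "brown_mccoy_radical R \<subseteq> B"
  proof
    fix r assume r: "r \<in> brown_mccoy_radical R"
    then have "r \<in> carrier R" by (auto simp: brown_mccoy_radical_def hemiring_ideal_def)
    then show "r \<in> B"
    proof (rule B_I)
      fix F and S :: "'a ring" assume FS: "onto_simple F S"
      show "F r = \<zero>\<^bsub>S\<^esub>"
        by (rule brown_mccoy_radical_vanishes[OF r]) (use FS in \<open>simp_all add: onto_simple_def\<close>)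
    qed
  qed
  ultimately have eq: "brown_mccoy_radical R = B" by (rule subset_antisym[rotated])
  then show "hemiring_ideal R (brown_mccoy_radical R)" using B by simp
  show "brown_mccoy_radical R =
    {r \<in> carrier R. \<forall>(S :: 'a ring) F. F \<in> hemiring_hom R S \<longrightarrow> F ` carrier R = carrier S \<longrightarrow>
       Ring.semiring S \<longrightarrow> ideal_simple S \<longrightarrow> F r = \<zero>\<^bsub>S\<^esub>}"
    by (simp only: eq B_def onto_simple_def imp_conjL)
qed

context square_matrices
begin

lemma ideal_simple_Mat:
  assumes "ideal_simple R"
  shows "ideal_simple Mat"
  unfolding ideal_simple_def
proof (intro allI impI)
  fix J assume J: "hemiring_ideal Mat J"
  define L where "L = {r \<in> carrier R. entry_mat 0 0 r \<in> J}"
  have "L = {\<zero>} \<or> L = carrier R"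
    using assms corner_ideal[OF J] unfolding ideal_simple_def L_def by blast
  moreover have "J = matrices_over n L"
    using J by (rule ideal_eq_matrices_over) (auto simp: L_def)
  moreover have "matrices_over n {\<zero>} = {\<zero>\<^bsub>Mat\<^esub>}"
    by (auto simp: matrices_over_def matrix_semiring_def)
  ultimately show "J = {\<zero>\<^bsub>Mat\<^esub>} \<or> J = carrier Mat" by (auto simp: carrier_Mat)
qed

lemma map_mat_hom:
  assumes S: "square_matrices S n" and F: "F \<in> hemiring_hom R S" "F ` carrier R = carrier S"
  shows "map_mat F \<in> hemiring_hom Mat (matrix_semiring n S)"
    and "map_mat F ` carrier Mat = carrier (matrix_semiring n S)"
proof -
  interpret S: square_matrices S n by fact
  have FS: "F r \<in> carrier S" if "r \<in> carrier R" for r using that F(2) by blast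
  have F_sum: "F (finsum R g X) = finsum S (\<lambda>k. F (g k)) X"
    if "finite X" "\<And>k. k \<in> X \<Longrightarrow> g k \<in> carrier R" for g :: "nat \<Rightarrow> 'a" and X
    using that
  proof (induction X rule: finite_induct)
    case (insert k X)
    then have "g \<in> X \<rightarrow> carrier R" "(\<lambda>k. F (g k)) \<in> X \<rightarrow> carrier S" "F (g k) \<in> carrier S"
      using FS by auto
    then show ?case using insert F by (simp add: hemiring_hom_def)
  qed (use F in \<open>simp add: hemiring_hom_def\<close>)
  have closed: "map_mat F A \<in> carrier (matrix_semiring n S)" if "A \<in> carrier Mat" for A
    using that FS by (auto simp: carrier_Mat S.carrier_Mat matrices_over_def)
  have ent: "map_mat F A $$ (i, j) = F (A $$ (i, j))" if "A \<in> carrier Mat" "i < n" "j < n" for A i j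
    using that by (simp add: dim_Mat)
  show "map_mat F \<in> hemiring_hom Mat (matrix_semiring n S)"
    unfolding hemiring_hom_def
  proof (intro CollectI conjI ballI)
    show "map_mat F \<zero>\<^bsub>Mat\<^esub> = \<zero>\<^bsub>matrix_semiring n S\<^esub>"
      using F by (intro S.Mat_eqI) (auto simp: ent zero_entry S.zero_entry hemiring_hom_def closed)
  next
    fix A B assume AB: "A \<in> carrier Mat" "B \<in> carrier Mat"
    show "map_mat F (A \<oplus>\<^bsub>Mat\<^esub> B) = map_mat F A \<oplus>\<^bsub>matrix_semiring n S\<^esub> map_mat F B"
      using F AB
      by (intro S.Mat_eqI) (auto simp: ent add_entry S.add_entry hemiring_hom_def closed entry_closed)
    show "map_mat F (A \<otimes>\<^bsub>Mat\<^esub> B) = map_mat F A \<otimes>\<^bsub>matrix_semiring n S\<^esub> map_mat F B"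
    proof (rule S.Mat_eqI)
      fix i j assume ij: "i < n" "j < n"
      have "map_mat F (A \<otimes>\<^bsub>Mat\<^esub> B) $$ (i, j) = F (\<Oplus>k\<in>{..<n}. A $$ (i, k) \<otimes> B $$ (k, j))"
        using AB ij by (simp only: ent mult_entry mat.m_closed)
      also have "\<dots> = (\<Oplus>\<^bsub>S\<^esub>k\<in>{..<n}. F (A $$ (i, k) \<otimes> B $$ (k, j)))"
        using AB ij by (intro F_sum) (auto simp: entry_closed)
      also have "\<dots> = (\<Oplus>\<^bsub>S\<^esub>k\<in>{..<n}. map_mat F A $$ (i, k) \<otimes>\<^bsub>S\<^esub> map_mat F B $$ (k, j))"
        using AB ij F FS
        by (intro S.finsum_cong') (auto simp del: index_map_mat
            simp: ent hemiring_hom_def entry_closed)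
      finally show "map_mat F (A \<otimes>\<^bsub>Mat\<^esub> B) $$ (i, j) =
          (map_mat F A \<otimes>\<^bsub>matrix_semiring n S\<^esub> map_mat F B) $$ (i, j)"
        using ij by (simp only: S.mult_entry)
    qed (use AB closed in auto)
  qed (use closed in auto)
  show "map_mat F ` carrier Mat = carrier (matrix_semiring n S)"
  proof (intro equalityI subsetI)
    fix B assume B: "B \<in> carrier (matrix_semiring n S)"
    define A where "A = mat n n (\<lambda>p. inv_into (carrier R) F (B $$ p))"
    have "F ` carrier R = carrier S" by fact
    then have inv: "inv_into (carrier R) F (B $$ (i, j)) \<in> carrier R"
      "F (inv_into (carrier R) F (B $$ (i, j))) = B $$ (i, j)" if "i < n" "j < n" for i j
      using S.entry_closed[OF B that] by (auto intro: inv_into_into f_inv_into_f)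
    then have A: "A \<in> carrier Mat" unfolding A_def by (intro mat_in_carrier) auto
    have "map_mat F A = B"
    proof (rule S.Mat_eqI)
      fix i j assume "i < n" "j < n"
      then show "map_mat F A $$ (i, j) = B $$ (i, j)" by (simp add: A_def inv)
    qed (use B closed A in auto)
    then show "B \<in> map_mat F ` carrier Mat" using A by blast
  qed (use closed in auto)
qed

text \<open>
  An ideal-simple image \<open>S\<close> of \<open>R\<close> yields the ideal-simple image of \<open>n \<times> n\<close> matrices over \<open>S\<close>.
\<close>

lemma entry_mat_brown_mccoy_radical_imp:
  assumes r: "r \<in> carrier R" and "entry_mat 0 0 r \<in> brown_mccoy_radical Mat"
  shows "r \<in> brown_mccoy_radical R"
proof -
  have "F r = \<zero>\<^bsub>S\<^esub>"
    if F: "F \<in> hemiring_hom R S" "F ` carrier R = carrier S"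
      and S: "Ring.semiring S" "ideal_simple S" for S :: "'a ring" and F
  proof -
    interpret S: square_matrices S n
      using S(1) dim_pos by (simp add: square_matrices_def square_matrices_axioms_def)
    have "map_mat F (entry_mat 0 0 r) = \<zero>\<^bsub>S.Mat\<^esub>"
      using assms(2) map_mat_hom[OF S.square_matrices_axioms F] S.mat.semiring_axioms
        S.ideal_simple_Mat[OF S(2)]
      by (rule brown_mccoy_radical_vanishes)
    then have "map_mat F (entry_mat 0 0 r) $$ (0, 0) = \<zero>\<^bsub>S\<^esub>"
      using dim_pos by (simp add: S.zero_entry)
    then show ?thesis using dim_pos r by (simp add: dim_Mat entry_mat_entry)
  qed
  then show ?thesis
    using r brown_mccoy_radical_eq(1)[OF semiring_imp_hemiring[OF semiring_axioms]] by blast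
qed

text \<open>
  Let \<open>F\<close> map the matrices onto an ideal-simple \<open>S\<close>. The corner \<open>C = F(e) S F(e)\<close>, where \<open>e\<close> is the
  matrix unit at \<open>(0, 0)\<close>, is an image of \<open>R\<close>. It is ideal-simple, since an ideal of \<open>C\<close> pulls back to
  an ideal of \<open>R\<close>, whose matrices are mapped to an ideal of \<open>S\<close>.
\<close>

lemma entry_mat_brown_mccoy_radical:
  assumes r: "r \<in> brown_mccoy_radical R"
  shows "entry_mat 0 0 r \<in> brown_mccoy_radical Mat"
proof -
  have rR: "r \<in> carrier R" using r by (auto simp: brown_mccoy_radical_def hemiring_ideal_def)
  have "F (entry_mat 0 0 r) = \<zero>\<^bsub>S\<^esub>"
    if F: "F \<in> hemiring_hom Mat S" "F ` carrier Mat = carrier S"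
      and S: "Ring.semiring S" "ideal_simple S" for S :: "'a mat ring" and F
  proof -
    interpret S: Ring.semiring S by fact
    define G where "G r = F (entry_mat 0 0 r)" for r
    define C where "C = S\<lparr>carrier := G ` carrier R, one := G \<one>\<rparr>"
    have F_add: "F (A \<oplus>\<^bsub>Mat\<^esub> B) = F A \<oplus>\<^bsub>S\<^esub> F B" and F_mult: "F (A \<otimes>\<^bsub>Mat\<^esub> B) = F A \<otimes>\<^bsub>S\<^esub> F B"
      if "A \<in> carrier Mat" "B \<in> carrier Mat" for A B
      using that F by (auto simp: hemiring_hom_def)
    have G_zero: "G \<zero> = \<zero>\<^bsub>S\<^esub>" using F by (auto simp: G_def hemiring_hom_def)
    have G_add: "G x \<oplus>\<^bsub>S\<^esub> G y = G (x \<oplus> y)" and G_mult: "G x \<otimes>\<^bsub>S\<^esub> G y = G (x \<otimes> y)"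
      if "x \<in> carrier R" "y \<in> carrier R" for x y
      using that dim_pos by (simp_all add: G_def entry_mat_mult flip: F_add F_mult entry_mat_add)
    have GS: "G x \<in> carrier S" if "x \<in> carrier R" for x
      using that F(2) by (auto simp: G_def)
    have G_hom: "G \<in> hemiring_hom R C" "G ` carrier R = carrier C"
      using GS by (auto simp: hemiring_hom_def C_def G_zero G_add G_mult)
    have "Ring.semiring C"
      using GS
      by unfold_locales
        (auto simp: C_def G_mult G_add a_ac m_assoc l_distr r_distr
          intro: image_eqI[of _ G "\<zero>"] simp flip: G_zero)
    moreover have "ideal_simple C"
      unfolding ideal_simple_def
    proof (intro allI impI)
      fix K assume K: "hemiring_ideal C K"
      have KG: "K \<subseteq> G ` carrier R" using K by (simp add: hemiring_ideal_def C_def)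
      define L where "L = {r \<in> carrier R. G r \<in> K}"
      have "hemiring_ideal R L"
        using K
        by (auto simp: hemiring_ideal_def C_def L_def G_zero simp flip: G_add G_mult)
      then have "hemiring_ideal S (F ` matrices_over n L)"
        using hom_image_ideal[OF F] matrices_over_ideal by blast
      then have "F ` matrices_over n L = {\<zero>\<^bsub>S\<^esub>} \<or> F ` matrices_over n L = carrier S"
        using S(2) by (simp add: ideal_simple_def)
      then show "K = {\<zero>\<^bsub>C\<^esub>} \<or> K = carrier C"
      proof
        assume zero: "F ` matrices_over n L = {\<zero>\<^bsub>S\<^esub>}"
        have "K \<subseteq> {\<zero>\<^bsub>S\<^esub>}"
        proof
          fix x assume x: "x \<in> K"
          obtain r where "r \<in> carrier R" "x = G r" using KG x by blast
          then have r: "r \<in> L" "x = G r" using x by (simp_all add: L_def)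
          have "\<zero> \<in> L" using \<open>hemiring_ideal R L\<close> by (simp add: hemiring_ideal_def)
          then have "entry_mat 0 0 r \<in> matrices_over n L"
            unfolding entry_mat_def using r by (intro mat_in_matrices_over) auto
          then have "G r \<in> F ` matrices_over n L" unfolding G_def by (rule imageI)
          then show "x \<in> {\<zero>\<^bsub>S\<^esub>}" unfolding zero r(2) .
        qed
        moreover have "\<zero>\<^bsub>S\<^esub> \<in> K" using K by (simp add: hemiring_ideal_def C_def)
        ultimately show ?thesis by (auto simp: C_def)
      next
        assume all: "F ` matrices_over n L = carrier S"
        have "G r \<in> K" if r: "r \<in> carrier R" for r
        proof -
          have "G r \<in> F ` matrices_over n L" using GS[OF r] all by simp
          then obtain A where A: "A \<in> matrices_over n L" "G r = F A" by blast
          then have AM: "A \<in> carrier Mat" by (auto simp: carrier_Mat matrices_over_def L_def)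
          \<comment> \<open>Compressing \<open>A\<close> to its corner does not change \<open>F A\<close>, which lies in the corner.\<close>
          have "G r = G \<one> \<otimes>\<^bsub>S\<^esub> G r \<otimes>\<^bsub>S\<^esub> G \<one>" using r by (simp add: G_mult)
          also have "\<dots> = G \<one> \<otimes>\<^bsub>S\<^esub> F A \<otimes>\<^bsub>S\<^esub> G \<one>" by (simp add: A)
          also have "\<dots> = F (entry_mat 0 0 \<one> \<otimes>\<^bsub>Mat\<^esub> A \<otimes>\<^bsub>Mat\<^esub> entry_mat 0 0 \<one>)"
            using AM by (simp add: G_def F_mult)
          also have "\<dots> = G (A $$ (0, 0))"
            using AM dim_pos by (simp add: G_def entry_mat_sandwich entry_closed)
          finally show ?thesis
            using A(1) dim_pos by (auto simp: matrices_over_def L_def)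
        qed
        then show ?thesis using KG by (auto simp: C_def)
      qed
    qed
    ultimately have "G r = \<zero>\<^bsub>C\<^esub>"
      using brown_mccoy_radical_vanishes[OF r G_hom] by blast
    then show ?thesis by (simp add: G_def C_def)
  qed
  moreover have "entry_mat 0 0 r \<in> carrier Mat" using rR by simp
  ultimately show ?thesis
    unfolding brown_mccoy_radical_eq(1)[OF semiring_imp_hemiring[OF mat.semiring_axioms]]
    by (intro CollectI conjI allI impI)
qed

lemma brown_mccoy_radical_Mat:
  "brown_mccoy_radical Mat = matrices_over n (brown_mccoy_radical R)"
proof (rule ideal_eq_matrices_over)
  show "hemiring_ideal Mat (brown_mccoy_radical Mat)"
    by (rule brown_mccoy_radical_eq(2)) (rule semiring_imp_hemiring[OF mat.semiring_axioms])
  show "brown_mccoy_radical R \<subseteq> carrier R"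
    by (auto simp: brown_mccoy_radical_def hemiring_ideal_def)
  show "entry_mat 0 0 r \<in> brown_mccoy_radical Mat \<longleftrightarrow> r \<in> brown_mccoy_radical R"
    if "r \<in> carrier R" for r
    using entry_mat_brown_mccoy_radical[of r] entry_mat_brown_mccoy_radical_imp[OF that] by metis
qed

end

section \<open>The radical of simple semimodules\<close>

context left_semimodule
begin

lemma smult_finsum_left:
  assumes "finite X" "\<And>k. k \<in> X \<Longrightarrow> f k \<in> carrier R" "m \<in> carrier M"
  shows "(\<Oplus>k\<in>X. f k) \<odot>\<^bsub>M\<^esub> m = (\<Oplus>\<^bsub>M\<^esub>k\<in>X. f k \<odot>\<^bsub>M\<^esub> m)"
  using assms
proof (induction X rule: finite_induct)
  case (insert k X)
  then have "f \<in> X \<rightarrow> carrier R" "f k \<in> carrier R"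
    "(\<lambda>k. f k \<odot>\<^bsub>M\<^esub> m) \<in> X \<rightarrow> carrier M" "f k \<odot>\<^bsub>M\<^esub> m \<in> carrier M"
    by (auto intro: smult_closed)
  then show ?case using insert by (simp add: smult_l_distr)
qed (simp add: smult_l_null)

lemma smult_finsum_right:
  assumes "finite X" "\<And>k. k \<in> X \<Longrightarrow> f k \<in> carrier M" "r \<in> carrier R"
  shows "r \<odot>\<^bsub>M\<^esub> (\<Oplus>\<^bsub>M\<^esub>k\<in>X. f k) = (\<Oplus>\<^bsub>M\<^esub>k\<in>X. r \<odot>\<^bsub>M\<^esub> f k)"
  using assms
proof (induction X rule: finite_induct)
  case (insert k X)
  then have "f \<in> X \<rightarrow> carrier M" "f k \<in> carrier M"
    "(\<lambda>k. r \<odot>\<^bsub>M\<^esub> f k) \<in> X \<rightarrow> carrier M" "r \<odot>\<^bsub>M\<^esub> f k \<in> carrier M"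
    by (auto intro: smult_closed)
  then show ?case using insert by (simp add: smult_r_distr)
qed (simp add: smult_r_null)

lemma annihilator_ideal: "hemiring_ideal R (semimodule_annihilator R M)"
  unfolding hemiring_ideal_def semimodule_annihilator_def
  by (auto simp: smult_l_null smult_l_distr smult_assoc smult_r_null smult_closed R.m_closed)

end

lemma simple_radical_ideal:
  fixes R :: "('a, 'b) ring_scheme"
  assumes "hemiring R"
  shows "hemiring_ideal R (simple_radical R)"
proof -
  interpret hemiring R by fact
  have "hemiring_ideal R (semimodule_annihilator R M)" if "simple_semimodule R M"
    for M :: "('a, 'a) module"
    using that by (intro left_semimodule.annihilator_ideal) (simp add: simple_semimodule_def)
  then show ?thesis
    unfolding hemiring_ideal_def simple_radical_def by (simp add: m_closed subset_iff)
qed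

text \<open>
  The action is not assumed to be unitary, but \<open>1 M\<close> is a subsemimodule on which \<open>1\<close> acts as the
  identity, and it is nonzero because \<open>R M = R (1 M)\<close>.
\<close>

lemma simple_semimodule_unital:
  assumes R: "Ring.semiring R" and M: "simple_semimodule R M" and m: "m \<in> carrier M"
  shows "\<one>\<^bsub>R\<^esub> \<odot>\<^bsub>M\<^esub> m = m"
proof -
  interpret S: Ring.semiring R by fact
  interpret left_semimodule R M using M by (simp add: simple_semimodule_def)
  let ?N = "(\<lambda>m. \<one>\<^bsub>R\<^esub> \<odot>\<^bsub>M\<^esub> m) ` carrier M"
  have absorb: "\<one>\<^bsub>R\<^esub> \<odot>\<^bsub>M\<^esub> (r \<odot>\<^bsub>M\<^esub> m) = r \<odot>\<^bsub>M\<^esub> m" "r \<odot>\<^bsub>M\<^esub> (\<one>\<^bsub>R\<^esub> \<odot>\<^bsub>M\<^esub> m) = r \<odot>\<^bsub>M\<^esub> m"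
    if "r \<in> carrier R" "m \<in> carrier M" for r m
    using that by (simp_all flip: smult_assoc)
  have "subsemimodule R M ?N"
    unfolding subsemimodule_def
  proof (intro conjI ballI)
    show "?N \<subseteq> carrier M" by (auto simp: smult_closed)
    show "\<zero>\<^bsub>M\<^esub> \<in> ?N" by (rule image_eqI[of _ _ "\<zero>\<^bsub>M\<^esub>"]) (simp_all add: smult_r_null)
  next
    fix x y assume "x \<in> ?N" "y \<in> ?N"
    then obtain a b where ab: "a \<in> carrier M" "b \<in> carrier M"
      "x = \<one>\<^bsub>R\<^esub> \<odot>\<^bsub>M\<^esub> a" "y = \<one>\<^bsub>R\<^esub> \<odot>\<^bsub>M\<^esub> b" by blast
    then show "x \<oplus>\<^bsub>M\<^esub> y \<in> ?N"
      by (intro image_eqI[of _ _ "a \<oplus>\<^bsub>M\<^esub> b"]) (simp_all add: smult_r_distr)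
  next
    fix r x assume r: "r \<in> carrier R" and "x \<in> ?N"
    then obtain a where a: "a \<in> carrier M" "x = \<one>\<^bsub>R\<^esub> \<odot>\<^bsub>M\<^esub> a" by blast
    then show "r \<odot>\<^bsub>M\<^esub> x \<in> ?N"
      using r by (intro image_eqI[of _ _ "r \<odot>\<^bsub>M\<^esub> a"]) (simp_all add: absorb smult_closed)
  qed
  moreover have "?N \<noteq> {\<zero>\<^bsub>M\<^esub>}"
  proof
    assume N: "?N = {\<zero>\<^bsub>M\<^esub>}"
    have "r \<odot>\<^bsub>M\<^esub> x = \<zero>\<^bsub>M\<^esub>" if rx: "r \<in> carrier R" "x \<in> carrier M" for r x
    proof -
      have "\<one>\<^bsub>R\<^esub> \<odot>\<^bsub>M\<^esub> x = \<zero>\<^bsub>M\<^esub>" using N rx by blast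
      then show ?thesis using absorb(2)[OF rx] rx by (simp add: smult_r_null)
    qed
    then show False using M unfolding simple_semimodule_def by blast
  qed
  ultimately have "?N = carrier M" using M unfolding simple_semimodule_def by blast
  then obtain x where "x \<in> carrier M" "m = \<one>\<^bsub>R\<^esub> \<odot>\<^bsub>M\<^esub> x" using m by blast
  then show ?thesis using absorb(1)[of "\<one>\<^bsub>R\<^esub>" x] by simp
qed

lemma simple_semimodule_cyclic:
  assumes R: "Ring.semiring R" and M: "simple_semimodule R M"
    and m: "m \<in> carrier M" "m \<noteq> \<zero>\<^bsub>M\<^esub>"
  shows "(\<lambda>r. r \<odot>\<^bsub>M\<^esub> m) ` carrier R = carrier M"
proof -
  interpret S: Ring.semiring R by fact
  interpret left_semimodule R M using M by (simp add: simple_semimodule_def)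
  let ?N = "(\<lambda>r. r \<odot>\<^bsub>M\<^esub> m) ` carrier R"
  have "subsemimodule R M ?N"
    unfolding subsemimodule_def
  proof (intro conjI ballI)
    show "?N \<subseteq> carrier M" using m by (auto simp: smult_closed)
    show "\<zero>\<^bsub>M\<^esub> \<in> ?N" using m by (intro image_eqI[of _ _ "\<zero>\<^bsub>R\<^esub>"]) (simp_all add: smult_l_null)
  next
    fix x y assume "x \<in> ?N" "y \<in> ?N"
    then obtain a b where ab: "a \<in> carrier R" "b \<in> carrier R" "x = a \<odot>\<^bsub>M\<^esub> m" "y = b \<odot>\<^bsub>M\<^esub> m"
      by blast
    then show "x \<oplus>\<^bsub>M\<^esub> y \<in> ?N"
      using m by (intro image_eqI[of _ _ "a \<oplus>\<^bsub>R\<^esub> b"]) (simp_all add: smult_l_distr)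
  next
    fix r x assume r: "r \<in> carrier R" and "x \<in> ?N"
    then obtain a where a: "a \<in> carrier R" "x = a \<odot>\<^bsub>M\<^esub> m" by blast
    then show "r \<odot>\<^bsub>M\<^esub> x \<in> ?N"
      using r m by (intro image_eqI[of _ _ "r \<otimes>\<^bsub>R\<^esub> a"]) (simp_all add: smult_assoc)
  qed
  moreover have "m \<in> ?N"
    by (rule image_eqI[of _ _ "\<one>\<^bsub>R\<^esub>"]) (simp_all add: simple_semimodule_unital[OF R M m(1)])
  then have "?N \<noteq> {\<zero>\<^bsub>M\<^esub>}" using m(2) by blast
  ultimately show ?thesis using M unfolding simple_semimodule_def by blast
qed

text \<open>
  Column vectors over a semimodule \<open>M\<close>. If \<open>M\<close> is simple, then by cyclicity every column has the form
  \<open>(r k m)\<close>, \<open>k < n\<close>, for any prescribed nonzero \<open>m\<close> in \<open>M\<close>. Matrices with a single nonzero column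
  therefore carry any given nonzero coordinate to any given column in one step.
\<close>

locale column_semimodule = square_matrices R n + left_semimodule R M
  for R :: "('a, 'b) ring_scheme" (structure) and n :: nat and M :: "('a, 'c, 'd) module_scheme" (structure)
begin

definition Col :: "('a mat, 'c vec) module" where
  "Col = \<lparr>carrier = {v. dim_vec v = n \<and> (\<forall>i<n. v $ i \<in> carrier M)},
     mult = undefined, one = undefined, zero = vec n (\<lambda>i. \<zero>\<^bsub>M\<^esub>),
     add = (\<lambda>v w. vec n (\<lambda>i. v $ i \<oplus>\<^bsub>M\<^esub> w $ i)),
     smult = (\<lambda>A v. vec n (\<lambda>i. \<Oplus>\<^bsub>M\<^esub>k\<in>{..<n}. A $$ (i, k) \<odot>\<^bsub>M\<^esub> v $ k))\<rparr>"

definition column_mat :: "nat \<Rightarrow> (nat \<Rightarrow> 'a) \<Rightarrow> 'a mat" where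
  "column_mat j r = mat n n (\<lambda>(k, l). if l = j then r k else \<zero>)"

lemma column_mat_closed: "(\<And>k. k < n \<Longrightarrow> r k \<in> carrier R) \<Longrightarrow> column_mat j r \<in> carrier Mat"
  unfolding column_mat_def by (intro mat_in_carrier) auto

lemma entry_mat_eq_column_mat: "entry_mat i j r = column_mat j (\<lambda>k. if k = i then r else \<zero>)"
  unfolding entry_mat_def column_mat_def by (rule eq_matI) auto

lemma smult_entry_closed:
  "\<lbrakk>A \<in> carrier Mat; v \<in> carrier Col; i < n; k < n\<rbrakk> \<Longrightarrow> A $$ (i, k) \<odot>\<^bsub>M\<^esub> v $ k \<in> carrier M"
  by (simp add: Col_def smult_closed entry_closed)

lemma column_mat_smult:
  assumes "j < n" "\<And>k. k < n \<Longrightarrow> r k \<in> carrier R" "v \<in> carrier Col"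
  shows "column_mat j r \<odot>\<^bsub>Col\<^esub> v = vec n (\<lambda>k. r k \<odot>\<^bsub>M\<^esub> v $ j)"
proof (rule eq_vecI)
  fix i assume "i < dim_vec (vec n (\<lambda>k. r k \<odot>\<^bsub>M\<^esub> v $ j))"
  then have i: "i < n" by simp
  have v: "\<And>k. k < n \<Longrightarrow> v $ k \<in> carrier M" using assms(3) by (simp add: Col_def)
  have "(\<Oplus>\<^bsub>M\<^esub>k\<in>{..<n}. column_mat j r $$ (i, k) \<odot>\<^bsub>M\<^esub> v $ k) = column_mat j r $$ (i, j) \<odot>\<^bsub>M\<^esub> v $ j"
    using assms(1,2) i v
    by (intro M.finsum_single_term) (auto simp: column_mat_def smult_closed smult_l_null)
  then show "(column_mat j r \<odot>\<^bsub>Col\<^esub> v) $ i = vec n (\<lambda>k. r k \<odot>\<^bsub>M\<^esub> v $ j) $ i"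
    using i assms(1) by (simp add: Col_def column_mat_def)
qed (simp add: Col_def)

lemma left_semimodule_Col: "left_semimodule Mat Col"
proof -
  have ent: "v $ k \<in> carrier M" if "v \<in> carrier Col" "k < n" for v k
    using that by (simp add: Col_def)
  have sum_closed: "(\<Oplus>\<^bsub>M\<^esub>k\<in>{..<n}. A $$ (i, k) \<odot>\<^bsub>M\<^esub> v $ k) \<in> carrier M"
    if "A \<in> carrier Mat" "v \<in> carrier Col" "i < n" for A v i
    using that by (intro M.finsum_closed) (auto simp: smult_entry_closed)
  have assoc: "(A \<otimes>\<^bsub>Mat\<^esub> B) \<odot>\<^bsub>Col\<^esub> v = A \<odot>\<^bsub>Col\<^esub> (B \<odot>\<^bsub>Col\<^esub> v)"
    if A: "A \<in> carrier Mat" and B: "B \<in> carrier Mat" and v: "v \<in> carrier Col" for A B v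
  proof (rule eq_vecI)
    fix i assume "i < dim_vec (A \<odot>\<^bsub>Col\<^esub> (B \<odot>\<^bsub>Col\<^esub> v))"
    then have i: "i < n" by (simp add: Col_def)
    have "((A \<otimes>\<^bsub>Mat\<^esub> B) \<odot>\<^bsub>Col\<^esub> v) $ i
        = (\<Oplus>\<^bsub>M\<^esub>k\<in>{..<n}. (\<Oplus>l\<in>{..<n}. A $$ (i, l) \<otimes> B $$ (l, k)) \<odot>\<^bsub>M\<^esub> v $ k)"
      using i smult_entry_closed[OF mat.m_closed[OF A B] v i]
      by (simp add: Col_def) (intro M.finsum_cong', auto simp: mult_entry)
    also have "\<dots> = (\<Oplus>\<^bsub>M\<^esub>k\<in>{..<n}. \<Oplus>\<^bsub>M\<^esub>l\<in>{..<n}. A $$ (i, l) \<odot>\<^bsub>M\<^esub> (B $$ (l, k) \<odot>\<^bsub>M\<^esub> v $ k))"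
    proof (rule M.finsum_cong'[OF refl])
      fix k assume "k \<in> {..<n}"
      then show "(\<Oplus>l\<in>{..<n}. A $$ (i, l) \<otimes> B $$ (l, k)) \<odot>\<^bsub>M\<^esub> v $ k
          = (\<Oplus>\<^bsub>M\<^esub>l\<in>{..<n}. A $$ (i, l) \<odot>\<^bsub>M\<^esub> (B $$ (l, k) \<odot>\<^bsub>M\<^esub> v $ k))"
        using i
        by (subst smult_finsum_left)
          (auto simp: smult_assoc entry_closed ent A B v smult_closed intro!: M.finsum_cong')
    qed (use i in \<open>auto simp: entry_closed ent A B v smult_closed intro!: M.finsum_closed\<close>)
    also have "\<dots> = (\<Oplus>\<^bsub>M\<^esub>l\<in>{..<n}. \<Oplus>\<^bsub>M\<^esub>k\<in>{..<n}. A $$ (i, l) \<odot>\<^bsub>M\<^esub> (B $$ (l, k) \<odot>\<^bsub>M\<^esub> v $ k))"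
      using i by (intro M.add.finprod_finprod_swap) (auto simp: entry_closed ent A B v smult_closed)
    also have "\<dots> = (\<Oplus>\<^bsub>M\<^esub>l\<in>{..<n}. A $$ (i, l) \<odot>\<^bsub>M\<^esub> (\<Oplus>\<^bsub>M\<^esub>k\<in>{..<n}. B $$ (l, k) \<odot>\<^bsub>M\<^esub> v $ k))"
      using i
      by (intro M.finsum_cong'[OF refl], goal_cases)
        (auto simp: entry_closed ent A B v smult_closed
          intro!: M.finsum_closed smult_finsum_right[symmetric])
    also have "\<dots> = (A \<odot>\<^bsub>Col\<^esub> (B \<odot>\<^bsub>Col\<^esub> v)) $ i"
      using i sum_closed[OF B v]
      by (simp add: Col_def) (intro M.finsum_cong', auto simp: entry_closed A smult_closed)
    finally show "((A \<otimes>\<^bsub>Mat\<^esub> B) \<odot>\<^bsub>Col\<^esub> v) $ i = (A \<odot>\<^bsub>Col\<^esub> (B \<odot>\<^bsub>Col\<^esub> v)) $ i" .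
  qed (simp add: Col_def)
  have smult_add: "A \<odot>\<^bsub>Col\<^esub> (v \<oplus>\<^bsub>Col\<^esub> w) = A \<odot>\<^bsub>Col\<^esub> v \<oplus>\<^bsub>Col\<^esub> A \<odot>\<^bsub>Col\<^esub> w"
    if A: "A \<in> carrier Mat" and v: "v \<in> carrier Col" and w: "w \<in> carrier Col" for A v w
  proof (rule eq_vecI)
    fix i assume "i < dim_vec (A \<odot>\<^bsub>Col\<^esub> v \<oplus>\<^bsub>Col\<^esub> A \<odot>\<^bsub>Col\<^esub> w)"
    then have i: "i < n" by (simp add: Col_def)
    have "(A \<odot>\<^bsub>Col\<^esub> (v \<oplus>\<^bsub>Col\<^esub> w)) $ i
        = (\<Oplus>\<^bsub>M\<^esub>k\<in>{..<n}. A $$ (i, k) \<odot>\<^bsub>M\<^esub> v $ k \<oplus>\<^bsub>M\<^esub> A $$ (i, k) \<odot>\<^bsub>M\<^esub> w $ k)"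
      using i by (simp add: Col_def)
        (intro M.finsum_cong', auto simp: smult_r_distr entry_closed ent A v w smult_closed)
    also have "\<dots> = (A \<odot>\<^bsub>Col\<^esub> v \<oplus>\<^bsub>Col\<^esub> A \<odot>\<^bsub>Col\<^esub> w) $ i"
      using i smult_entry_closed[OF A v i] smult_entry_closed[OF A w i]
      by (subst M.finsum_addf) (auto simp: Col_def)
    finally show "(A \<odot>\<^bsub>Col\<^esub> (v \<oplus>\<^bsub>Col\<^esub> w)) $ i = (A \<odot>\<^bsub>Col\<^esub> v \<oplus>\<^bsub>Col\<^esub> A \<odot>\<^bsub>Col\<^esub> w) $ i" .
  qed (simp add: Col_def)
  have add_smult: "(A \<oplus>\<^bsub>Mat\<^esub> B) \<odot>\<^bsub>Col\<^esub> v = A \<odot>\<^bsub>Col\<^esub> v \<oplus>\<^bsub>Col\<^esub> B \<odot>\<^bsub>Col\<^esub> v"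
    if A: "A \<in> carrier Mat" and B: "B \<in> carrier Mat" and v: "v \<in> carrier Col" for A B v
  proof (rule eq_vecI)
    fix i assume "i < dim_vec (A \<odot>\<^bsub>Col\<^esub> v \<oplus>\<^bsub>Col\<^esub> B \<odot>\<^bsub>Col\<^esub> v)"
    then have i: "i < n" by (simp add: Col_def)
    have "((A \<oplus>\<^bsub>Mat\<^esub> B) \<odot>\<^bsub>Col\<^esub> v) $ i
        = (\<Oplus>\<^bsub>M\<^esub>k\<in>{..<n}. A $$ (i, k) \<odot>\<^bsub>M\<^esub> v $ k \<oplus>\<^bsub>M\<^esub> B $$ (i, k) \<odot>\<^bsub>M\<^esub> v $ k)"
      using i by (simp add: Col_def)
        (intro M.finsum_cong', auto simp: add_entry smult_l_distr entry_closed ent A B v smult_closed)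
    also have "\<dots> = (A \<odot>\<^bsub>Col\<^esub> v \<oplus>\<^bsub>Col\<^esub> B \<odot>\<^bsub>Col\<^esub> v) $ i"
      using i smult_entry_closed[OF A v i] smult_entry_closed[OF B v i]
      by (subst M.finsum_addf) (auto simp: Col_def)
    finally show "((A \<oplus>\<^bsub>Mat\<^esub> B) \<odot>\<^bsub>Col\<^esub> v) $ i = (A \<odot>\<^bsub>Col\<^esub> v \<oplus>\<^bsub>Col\<^esub> B \<odot>\<^bsub>Col\<^esub> v) $ i" .
  qed (simp add: Col_def)
  have smult_zero: "A \<odot>\<^bsub>Col\<^esub> \<zero>\<^bsub>Col\<^esub> = \<zero>\<^bsub>Col\<^esub>" if A: "A \<in> carrier Mat" for A
  proof (rule eq_vecI)
    fix i assume "i < dim_vec \<zero>\<^bsub>Col\<^esub>"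
    then have i: "i < n" by (simp add: Col_def)
    then have "(\<Oplus>\<^bsub>M\<^esub>k\<in>{..<n}. A $$ (i, k) \<odot>\<^bsub>M\<^esub> vec n (\<lambda>i. \<zero>\<^bsub>M\<^esub>) $ k) = (\<Oplus>\<^bsub>M\<^esub>k\<in>{..<n}. \<zero>\<^bsub>M\<^esub>)"
      by (intro M.finsum_cong') (auto simp: smult_r_null entry_closed A)
    then show "(A \<odot>\<^bsub>Col\<^esub> \<zero>\<^bsub>Col\<^esub>) $ i = \<zero>\<^bsub>Col\<^esub> $ i" using i by (simp add: Col_def)
  qed (simp add: Col_def)
  have zero_smult: "\<zero>\<^bsub>Mat\<^esub> \<odot>\<^bsub>Col\<^esub> v = \<zero>\<^bsub>Col\<^esub>" if v: "v \<in> carrier Col" for v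
  proof (rule eq_vecI)
    fix i assume "i < dim_vec \<zero>\<^bsub>Col\<^esub>"
    then have i: "i < n" by (simp add: Col_def)
    then have "(\<Oplus>\<^bsub>M\<^esub>k\<in>{..<n}. \<zero>\<^bsub>Mat\<^esub> $$ (i, k) \<odot>\<^bsub>M\<^esub> v $ k) = (\<Oplus>\<^bsub>M\<^esub>k\<in>{..<n}. \<zero>\<^bsub>M\<^esub>)"
      by (intro M.finsum_cong') (auto simp: smult_l_null zero_entry ent v)
    then show "(\<zero>\<^bsub>Mat\<^esub> \<odot>\<^bsub>Col\<^esub> v) $ i = \<zero>\<^bsub>Col\<^esub> $ i" using i by (simp add: Col_def)
  qed (simp add: Col_def)
  have monoid: "abelian_monoid Col"
    by (intro abelian_monoidI) (auto simp: Col_def M.a_ac)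
  have closed: "A \<odot>\<^bsub>Col\<^esub> v \<in> carrier Col" if "A \<in> carrier Mat" "v \<in> carrier Col" for A v
    using sum_closed[OF that] by (simp add: Col_def)
  show ?thesis
    using semiring_imp_hemiring[OF mat.semiring_axioms] monoid closed assoc smult_add add_smult
      smult_zero zero_smult
    by (intro left_semimodule.intro left_semimodule_axioms.intro)
qed

lemma simple_Col:
  assumes M: "simple_semimodule R M"
  shows "simple_semimodule Mat Col"
proof -
  interpret Col: left_semimodule Mat Col by (rule left_semimodule_Col)
  obtain r0 m0 where m0: "r0 \<in> carrier R" "m0 \<in> carrier M" "r0 \<odot>\<^bsub>M\<^esub> m0 \<noteq> \<zero>\<^bsub>M\<^esub>"
    using M unfolding simple_semimodule_def by blast
  have m0_nz: "m0 \<noteq> \<zero>\<^bsub>M\<^esub>" using m0 smult_r_null by auto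
  have ent: "v $ k \<in> carrier M" if "v \<in> carrier Col" "k < n" for v k
    using that by (simp add: Col_def)
  have coords: "\<exists>r. (\<forall>k. r k \<in> carrier R) \<and> y = vec n (\<lambda>k. r k \<odot>\<^bsub>M\<^esub> m)"
    if m: "m \<in> carrier M" "m \<noteq> \<zero>\<^bsub>M\<^esub>" and y: "y \<in> carrier Col" for m y
  proof -
    have "\<exists>s\<in>carrier R. k < n \<longrightarrow> y $ k = s \<odot>\<^bsub>M\<^esub> m" for k
      using simple_semimodule_cyclic[OF semiring_axioms M m] ent[OF y, of k] zero_closed
      by (cases "k < n") (blast, blast)
    then obtain r where "\<And>k. r k \<in> carrier R" "\<And>k. k < n \<Longrightarrow> y $ k = r k \<odot>\<^bsub>M\<^esub> m" by metis
    moreover have "dim_vec y = n" using y by (simp add: Col_def)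
    ultimately show ?thesis by (intro exI[of _ r] conjI allI eq_vecI) auto
  qed
  have "\<exists>A\<in>carrier Mat. \<exists>v\<in>carrier Col. A \<odot>\<^bsub>Col\<^esub> v \<noteq> \<zero>\<^bsub>Col\<^esub>"
  proof (intro bexI)
    let ?v = "vec n (\<lambda>_. m0)"
    show v: "?v \<in> carrier Col" using m0 by (simp add: Col_def)
    show "column_mat 0 (\<lambda>_. r0) \<in> carrier Mat" using m0 by (intro column_mat_closed)
    have "(column_mat 0 (\<lambda>_. r0) \<odot>\<^bsub>Col\<^esub> ?v) $ 0 \<noteq> \<zero>\<^bsub>Col\<^esub> $ 0"
      using column_mat_smult[OF dim_pos _ v, of "\<lambda>_. r0"] m0 dim_pos by (simp add: Col_def)
    then show "column_mat 0 (\<lambda>_. r0) \<odot>\<^bsub>Col\<^esub> ?v \<noteq> \<zero>\<^bsub>Col\<^esub>" by metis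
  qed
  moreover have "K = {\<zero>\<^bsub>Col\<^esub>} \<or> K = carrier Col" if K: "subsemimodule Mat Col K" for K
  proof (cases "K \<subseteq> {\<zero>\<^bsub>Col\<^esub>}")
    case True
    then show ?thesis using K by (auto simp: subsemimodule_def)
  next
    case False
    then obtain x where x: "x \<in> K" "x \<noteq> \<zero>\<^bsub>Col\<^esub>" by blast
    have xC: "x \<in> carrier Col" using x K by (auto simp: subsemimodule_def)
    obtain i where i: "i < n" "x $ i \<noteq> \<zero>\<^bsub>M\<^esub>"
    proof (rule ccontr)
      assume "\<not> thesis"
      with that have "\<And>i. i < n \<Longrightarrow> x $ i = \<zero>\<^bsub>M\<^esub>" by blast
      then have "x = \<zero>\<^bsub>Col\<^esub>" using xC by (intro eq_vecI) (simp_all add: Col_def)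
      then show False using x by simp
    qed
    have "y \<in> K" if y: "y \<in> carrier Col" for y
    proof -
      obtain r where r: "\<And>k. r k \<in> carrier R" "y = vec n (\<lambda>k. r k \<odot>\<^bsub>M\<^esub> x $ i)"
        using coords[OF ent[OF xC i(1)] i(2) y] by blast
      then have "y = column_mat i r \<odot>\<^bsub>Col\<^esub> x" using i xC by (simp add: column_mat_smult)
      then show ?thesis using K x column_mat_closed[of r i] r by (simp add: subsemimodule_def)
    qed
    then show ?thesis using K by (auto simp: subsemimodule_def)
  qed
  moreover have "C = Id_on (carrier Col) \<or> C = carrier Col \<times> carrier Col"
    if C: "semimodule_congruence Mat Col C" for C
  proof -
    have eq: "equiv (carrier Col) C" using C by (simp add: semimodule_congruence_def)
    have C_sub: "C \<subseteq> carrier Col \<times> carrier Col" and C_refl: "\<And>x. x \<in> carrier Col \<Longrightarrow> (x, x) \<in> C"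
      and C_sym: "\<And>x y. (x, y) \<in> C \<Longrightarrow> (y, x) \<in> C"
      and C_trans: "\<And>x y z. (x, y) \<in> C \<Longrightarrow> (y, z) \<in> C \<Longrightarrow> (x, z) \<in> C"
      using eq unfolding equiv_def by (auto simp: refl_on_def dest: symD transD)
    have C_add: "(x \<oplus>\<^bsub>Col\<^esub> y, x' \<oplus>\<^bsub>Col\<^esub> y') \<in> C" if "(x, x') \<in> C" "(y, y') \<in> C" for x x' y y'
      using C that by (simp add: semimodule_congruence_def)
    have C_smult: "(A \<odot>\<^bsub>Col\<^esub> x, A \<odot>\<^bsub>Col\<^esub> x') \<in> C" if "A \<in> carrier Mat" "(x, x') \<in> C" for A x x'
      using C that by (simp add: semimodule_congruence_def)
    show ?thesis
    proof (cases "C \<subseteq> Id")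
      case True
      then show ?thesis using C_sub C_refl by auto
    next
      case False
      then obtain x y where xy: "(x, y) \<in> C" "x \<noteq> y" by auto
      have xyC: "x \<in> carrier Col" "y \<in> carrier Col" using xy C_sub by auto
      obtain i where i: "i < n" "x $ i \<noteq> y $ i"
      proof (rule ccontr)
        assume "\<not> thesis"
        with that have "\<And>i. i < n \<Longrightarrow> x $ i = y $ i" by blast
        then have "x = y" using xyC by (intro eq_vecI) (simp_all add: Col_def)
        then show False using xy by simp
      qed
      define V where "V r a = vec n (\<lambda>k. r k \<odot>\<^bsub>M\<^esub> a)" for r :: "nat \<Rightarrow> 'a" and a
      define rows where "rows = {r :: nat \<Rightarrow> 'a. \<forall>k. r k \<in> carrier R}"
      \<comment> \<open>Quantifying over all multiplier sequences makes \<open>D\<close> stable under scalars and lets a single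
        pair in \<open>D\<close> determine whole columns.\<close>
      define D where "D = {(a, b) \<in> carrier M \<times> carrier M. \<forall>r\<in>rows. (V r a, V r b) \<in> C}"
      have V_closed: "V r a \<in> carrier Col" if "r \<in> rows" "a \<in> carrier M" for r a
        using that by (simp add: V_def rows_def Col_def smult_closed)
      have V_add: "V r (a \<oplus>\<^bsub>M\<^esub> b) = V r a \<oplus>\<^bsub>Col\<^esub> V r b"
        if "r \<in> rows" "a \<in> carrier M" "b \<in> carrier M" for r a b
        using that by (intro eq_vecI) (simp_all add: V_def rows_def Col_def smult_r_distr)
      have V_smult: "V r (s \<odot>\<^bsub>M\<^esub> a) = V (\<lambda>k. r k \<otimes> s) a"
        if "r \<in> rows" "s \<in> carrier R" "a \<in> carrier M" for r s a
        using that by (intro eq_vecI) (simp_all add: V_def rows_def smult_assoc)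
      have V_column: "V r (v $ i) = column_mat i r \<odot>\<^bsub>Col\<^esub> v" if "r \<in> rows" "v \<in> carrier Col" for r v
        using that i by (simp add: V_def rows_def column_mat_smult)
      have "semimodule_congruence R M D"
        unfolding semimodule_congruence_def
      proof (intro conjI allI impI ballI)
        show "equiv (carrier M) D"
        proof (rule equivI)
          show "D \<subseteq> carrier M \<times> carrier M" by (auto simp: D_def)
          show "refl_on (carrier M) D" by (auto simp: D_def refl_on_def V_closed C_refl)
          show "sym D" by (auto simp: D_def sym_def C_sym)
          show "trans D" unfolding D_def trans_def using C_trans by blast
        qed
      next
        fix a a' b b' assume "(a, a') \<in> D" "(b, b') \<in> D"
        then show "(a \<oplus>\<^bsub>M\<^esub> b, a' \<oplus>\<^bsub>M\<^esub> b') \<in> D" by (auto simp: D_def V_add C_add)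
      next
        fix s a a' assume s: "s \<in> carrier R" and "(a, a') \<in> D"
        moreover have "(\<lambda>k. r k \<otimes> s) \<in> rows" if "r \<in> rows" for r
          using s that by (simp add: rows_def)
        ultimately show "(s \<odot>\<^bsub>M\<^esub> a, s \<odot>\<^bsub>M\<^esub> a') \<in> D"
          by (auto simp: D_def V_smult smult_closed)
      qed
      moreover have "(x $ i, y $ i) \<in> D"
        unfolding D_def
        using xyC i(1) xy(1) by (auto simp: ent V_column rows_def intro!: C_smult column_mat_closed)
      then have "D \<noteq> Id_on (carrier M)" using i(2) by (auto simp: Id_on_def)
      ultimately have D: "D = carrier M \<times> carrier M"
        using M unfolding simple_semimodule_def by blast
      have "(v, \<zero>\<^bsub>Col\<^esub>) \<in> C" if v: "v \<in> carrier Col" for v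
      proof -
        obtain r where r: "r \<in> rows" "v = V r m0"
          using coords[OF m0(2) m0_nz v] by (auto simp: rows_def V_def)
        have "(m0, \<zero>\<^bsub>M\<^esub>) \<in> D" using D m0 by simp
        then have "(V r m0, V r \<zero>\<^bsub>M\<^esub>) \<in> C" using r(1) by (auto simp: D_def)
        moreover have "V r \<zero>\<^bsub>M\<^esub> = \<zero>\<^bsub>Col\<^esub>"
          using r(1) by (intro eq_vecI) (simp_all add: V_def rows_def Col_def smult_r_null)
        ultimately show ?thesis using r(2) by simp
      qed
      then have "carrier Col \<times> carrier Col \<subseteq> C" using C_sym C_trans by blast
      then show ?thesis using C_sub by blast
    qed
  qed
  ultimately show ?thesis
    unfolding simple_semimodule_def using left_semimodule_Col by blast
qed

lemma annihilates_if_entry_mat_annihilates_Col: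
  assumes r: "r \<in> carrier R" and "entry_mat 0 0 r \<in> semimodule_annihilator Mat Col"
  shows "r \<in> semimodule_annihilator R M"
proof -
  have "r \<odot>\<^bsub>M\<^esub> m = \<zero>\<^bsub>M\<^esub>" if m: "m \<in> carrier M" for m
  proof -
    have v: "vec n (\<lambda>_. m) \<in> carrier Col" using m by (simp add: Col_def)
    then have "column_mat 0 (\<lambda>k. if k = 0 then r else \<zero>) \<odot>\<^bsub>Col\<^esub> vec n (\<lambda>_. m) = \<zero>\<^bsub>Col\<^esub>"
      using assms(2) by (simp add: semimodule_annihilator_def entry_mat_eq_column_mat)
    then have "vec n (\<lambda>k. (if k = 0 then r else \<zero>) \<odot>\<^bsub>M\<^esub> vec n (\<lambda>_. m) $ 0) $ 0 = \<zero>\<^bsub>Col\<^esub> $ 0"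
      using r by (simp add: column_mat_smult dim_pos v)
    then show ?thesis using dim_pos by (simp add: Col_def)
  qed
  then show ?thesis using r by (simp add: semimodule_annihilator_def)
qed

end

text \<open>
  For a simple semimodule \<open>N\<close> over the matrices, the corner \<open>e N\<close> with \<open>e\<close> the matrix unit at
  \<open>(0, 0)\<close> is a semimodule over \<open>R\<close>, the scalar \<open>r\<close> acting as the matrix with corner entry \<open>r\<close>.
\<close>

locale corner_semimodule = square_matrices R n + N?: left_semimodule Mat N
  for R :: "('a, 'b) ring_scheme" (structure) and n :: nat
    and N :: "('a mat, 'c, 'd) module_scheme" (structure) +
  assumes simple: "simple_semimodule Mat N"
begin

abbreviation (input) act :: "'a mat \<Rightarrow> 'c \<Rightarrow> 'c" where "act A x \<equiv> A \<odot>\<^bsub>N\<^esub> x"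
abbreviation E :: "'a \<Rightarrow> 'a mat" where "E \<equiv> entry_mat 0 0"

definition Corner :: "('a, 'c) module" where
  "Corner = \<lparr>carrier = {x \<in> carrier N. act (E \<one>) x = x}, mult = undefined, one = undefined,
     zero = \<zero>\<^bsub>N\<^esub>, add = add N, smult = (\<lambda>r x. act (E r) x)\<rparr>"

lemma E_mult: "\<lbrakk>r \<in> carrier R; s \<in> carrier R\<rbrakk> \<Longrightarrow> E r \<otimes>\<^bsub>Mat\<^esub> E s = E (r \<otimes> s)"
  using dim_pos by (simp add: entry_mat_mult)

lemma E_sandwich:
  "A \<in> carrier Mat \<Longrightarrow> E \<one> \<otimes>\<^bsub>Mat\<^esub> A \<otimes>\<^bsub>Mat\<^esub> E \<one> = E (A $$ (0, 0))"
  using dim_pos by (simp add: entry_mat_sandwich entry_closed)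

lemma E_act:
  assumes "r \<in> carrier R" "x \<in> carrier N"
  shows "act (E \<one>) (act (E r) x) = act (E r) x" "act (E r) (act (E \<one>) x) = act (E r) x"
  using assms by (simp_all add: E_mult flip: smult_assoc)

lemma left_semimodule_Corner: "left_semimodule R Corner"
proof -
  have "abelian_monoid Corner"
    by (intro abelian_monoidI) (auto simp: Corner_def N.M.a_ac smult_r_distr smult_r_null)
  moreover have "left_semimodule_axioms R Corner"
    by (intro left_semimodule_axioms.intro)
      (auto simp: Corner_def E_act smult_closed smult_r_distr smult_r_null smult_l_null
        smult_assoc smult_l_distr simp flip: E_mult entry_mat_add)
  ultimately show ?thesis
    using semiring_imp_hemiring[OF semiring_axioms] by (intro left_semimodule.intro)
qed

text \<open>
  The annihilator is an ideal, and the only ideal containing \<open>E \<one>\<close> is the whole matrix semiring.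
\<close>

lemma E_not_annihilating: "\<exists>x\<in>carrier N. act (E \<one>) x \<noteq> \<zero>\<^bsub>N\<^esub>"
proof (rule ccontr)
  assume "\<not> ?thesis"
  then have e: "E \<one> \<in> semimodule_annihilator Mat N" by (simp add: semimodule_annihilator_def)
  have "E r \<in> semimodule_annihilator Mat N" if "r \<in> carrier R" for r
  proof -
    have "E r \<otimes>\<^bsub>Mat\<^esub> E \<one> \<in> semimodule_annihilator Mat N"
      using e that N.annihilator_ideal by (simp add: hemiring_ideal_def)
    then show ?thesis using that by (simp add: E_mult)
  qed
  then have "carrier Mat \<subseteq> semimodule_annihilator Mat N"
    using ideal_entries[OF N.annihilator_ideal] entry_closed by blast
  then show False
    using simple unfolding simple_semimodule_def semimodule_annihilator_def by blast
qed

text \<open>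
  Subsemimodules and congruences of the corner are enlarged to \<open>N\<close> by a residual construction:
  \<open>x\<close> is admitted when \<open>e A x\<close> lies in the given subsemimodule for every matrix \<open>A\<close>, and likewise for
  pairs. This is stable under all matrices by construction, and restricts to the given object on the
  corner because \<open>e A e\<close> is the scalar in the corner of \<open>A\<close>.
\<close>

lemma simple_Corner: "simple_semimodule R Corner"
proof -
  have one_N: "act \<one>\<^bsub>Mat\<^esub> x = x" if "x \<in> carrier N" for x
    using that by (rule simple_semimodule_unital[OF mat.semiring_axioms simple])
  have corner: "x \<in> carrier N" "act (E \<one>) x = x" if "x \<in> carrier Corner" for x
    using that by (simp_all add: Corner_def)
  have act_corner: "act (E \<one> \<otimes>\<^bsub>Mat\<^esub> A) x = act (E (A $$ (0, 0))) x"
    if A: "A \<in> carrier Mat" and x: "x \<in> carrier Corner" for A x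
  proof -
    have "act (E \<one> \<otimes>\<^bsub>Mat\<^esub> A) x = act (E \<one> \<otimes>\<^bsub>Mat\<^esub> A) (act (E \<one>) x)" using x corner by simp
    then show ?thesis using A corner(1)[OF x] by (simp add: E_sandwich flip: smult_assoc)
  qed
  obtain x where x: "x \<in> carrier N" "act (E \<one>) x \<noteq> \<zero>\<^bsub>N\<^esub>" using E_not_annihilating by blast
  have "\<exists>r\<in>carrier R. \<exists>y\<in>carrier Corner. r \<odot>\<^bsub>Corner\<^esub> y \<noteq> \<zero>\<^bsub>Corner\<^esub>"
    using x by (intro bexI[of _ \<one>] bexI[of _ "act (E \<one>) x"])
      (simp_all add: Corner_def E_act smult_closed)
  moreover have "K = {\<zero>\<^bsub>Corner\<^esub>} \<or> K = carrier Corner" if K: "subsemimodule R Corner K" for K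
  proof -
    define L where "L = {x \<in> carrier N. \<forall>A\<in>carrier Mat. act (E \<one> \<otimes>\<^bsub>Mat\<^esub> A) x \<in> K}"
    have KC: "K \<subseteq> carrier Corner" and K_zero: "\<zero>\<^bsub>N\<^esub> \<in> K"
      and K_add: "\<And>x y. x \<in> K \<Longrightarrow> y \<in> K \<Longrightarrow> x \<oplus>\<^bsub>N\<^esub> y \<in> K"
      and K_smult: "\<And>r x. r \<in> carrier R \<Longrightarrow> x \<in> K \<Longrightarrow> act (E r) x \<in> K"
      using K by (auto simp: subsemimodule_def Corner_def)
    have KL: "K \<subseteq> L"
    proof
      fix x assume x: "x \<in> K"
      then show "x \<in> L"
        using KC corner dim_pos by (auto simp: L_def act_corner subset_iff K_smult entry_closed)
    qed
    have LK: "carrier Corner \<inter> L \<subseteq> K"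
    proof
      fix x assume x: "x \<in> carrier Corner \<inter> L"
      then have "act (E \<one> \<otimes>\<^bsub>Mat\<^esub> \<one>\<^bsub>Mat\<^esub>) x \<in> K" using L_def mat.one_closed by blast
      then show "x \<in> K" using x by (simp add: corner)
    qed
    have "subsemimodule Mat N L"
      unfolding subsemimodule_def
    proof (intro conjI ballI)
      show "\<zero>\<^bsub>N\<^esub> \<in> L" by (simp add: L_def smult_r_null K_zero)
    next
      fix x y assume "x \<in> L" "y \<in> L"
      then show "x \<oplus>\<^bsub>N\<^esub> y \<in> L" by (simp add: L_def smult_r_distr K_add)
    next
      fix B x assume B: "B \<in> carrier Mat" and x: "x \<in> L"
      have "act (E \<one> \<otimes>\<^bsub>Mat\<^esub> A) (act B x) \<in> K" if A: "A \<in> carrier Mat" for A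
      proof -
        have "act (E \<one> \<otimes>\<^bsub>Mat\<^esub> A) (act B x) = act (E \<one> \<otimes>\<^bsub>Mat\<^esub> (A \<otimes>\<^bsub>Mat\<^esub> B)) x"
          using A B x by (simp add: L_def mat.m_assoc flip: smult_assoc)
        then show ?thesis using A B x by (simp add: L_def)
      qed
      then show "act B x \<in> L" using B x by (simp add: L_def smult_closed)
    qed (simp add: L_def)
    then have "L = {\<zero>\<^bsub>N\<^esub>} \<or> L = carrier N" using simple unfolding simple_semimodule_def by blast
    then show ?thesis
    proof
      assume "L = {\<zero>\<^bsub>N\<^esub>}"
      then have "K = {\<zero>\<^bsub>N\<^esub>}" using KL K_zero by blast
      then show ?thesis by (simp add: Corner_def)
    next
      assume "L = carrier N"
      then show ?thesis using LK KC corner(1) by blast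
    qed
  qed
  moreover have "C = Id_on (carrier Corner) \<or> C = carrier Corner \<times> carrier Corner"
    if C: "semimodule_congruence R Corner C" for C
  proof -
    define D where "D = {(x, y) \<in> carrier N \<times> carrier N.
      \<forall>A\<in>carrier Mat. (act (E \<one> \<otimes>\<^bsub>Mat\<^esub> A) x, act (E \<one> \<otimes>\<^bsub>Mat\<^esub> A) y) \<in> C}"
    have eq: "equiv (carrier Corner) C" using C by (simp add: semimodule_congruence_def)
    have C_sub: "C \<subseteq> carrier Corner \<times> carrier Corner"
      and C_refl: "\<And>x. x \<in> carrier Corner \<Longrightarrow> (x, x) \<in> C"
      and C_sym: "\<And>x y. (x, y) \<in> C \<Longrightarrow> (y, x) \<in> C"
      and C_trans: "\<And>x y z. (x, y) \<in> C \<Longrightarrow> (y, z) \<in> C \<Longrightarrow> (x, z) \<in> C"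
      using eq unfolding equiv_def by (auto simp: refl_on_def dest: symD transD)
    have C_add: "(x \<oplus>\<^bsub>N\<^esub> y, x' \<oplus>\<^bsub>N\<^esub> y') \<in> C" if "(x, x') \<in> C" "(y, y') \<in> C" for x x' y y'
      using C that by (simp add: semimodule_congruence_def Corner_def)
    have C_smult: "(act (E r) x, act (E r) x') \<in> C" if "r \<in> carrier R" "(x, x') \<in> C" for r x x'
      using C that by (simp add: semimodule_congruence_def Corner_def)
    have in_corner: "act (E \<one> \<otimes>\<^bsub>Mat\<^esub> A) x \<in> carrier Corner"
      if "A \<in> carrier Mat" "x \<in> carrier N" for A x
      using that by (simp add: Corner_def smult_assoc smult_closed E_act)
    have CD: "C \<subseteq> D"
    proof
      fix p assume p: "p \<in> C"
      obtain x y where xy: "p = (x, y)" by force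
      have "x \<in> carrier Corner" "y \<in> carrier Corner" using p xy C_sub by auto
      then show "p \<in> D"
        using p xy dim_pos by (auto simp: D_def act_corner corner C_smult entry_closed)
    qed
    have DC: "D \<inter> (carrier Corner \<times> carrier Corner) \<subseteq> C"
    proof
      fix p assume p: "p \<in> D \<inter> (carrier Corner \<times> carrier Corner)"
      obtain x y where xy: "p = (x, y)" by force
      have "(act (E \<one> \<otimes>\<^bsub>Mat\<^esub> \<one>\<^bsub>Mat\<^esub>) x, act (E \<one> \<otimes>\<^bsub>Mat\<^esub> \<one>\<^bsub>Mat\<^esub>) y) \<in> C"
        using p mat.one_closed unfolding D_def xy by blast
      then show "p \<in> C" using p by (simp add: corner xy)
    qed
    have "semimodule_congruence Mat N D"
      unfolding semimodule_congruence_def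
    proof (intro conjI allI impI ballI)
      show "equiv (carrier N) D"
      proof (rule equivI)
        show "D \<subseteq> carrier N \<times> carrier N" by (auto simp: D_def)
        show "refl_on (carrier N) D" by (auto simp: D_def refl_on_def in_corner C_refl)
        show "sym D" by (auto simp: D_def sym_def C_sym)
        show "trans D" unfolding D_def trans_def using C_trans by blast
      qed
    next
      fix x x' y y' assume "(x, x') \<in> D" "(y, y') \<in> D"
      then show "(x \<oplus>\<^bsub>N\<^esub> y, x' \<oplus>\<^bsub>N\<^esub> y') \<in> D" by (auto simp: D_def smult_r_distr C_add)
    next
      fix B x x' assume B: "B \<in> carrier Mat" and xx: "(x, x') \<in> D"
      have x: "x \<in> carrier N" "x' \<in> carrier N" using xx by (auto simp: D_def)
      have "(act (E \<one> \<otimes>\<^bsub>Mat\<^esub> A) (act B x), act (E \<one> \<otimes>\<^bsub>Mat\<^esub> A) (act B x')) \<in> C"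
        if A: "A \<in> carrier Mat" for A
      proof -
        have "act (E \<one> \<otimes>\<^bsub>Mat\<^esub> A) (act B z) = act (E \<one> \<otimes>\<^bsub>Mat\<^esub> (A \<otimes>\<^bsub>Mat\<^esub> B)) z"
          if "z \<in> carrier N" for z
          using A B that by (simp add: mat.m_assoc flip: smult_assoc)
        then show ?thesis using A B x xx by (simp add: D_def)
      qed
      then show "(act B x, act B x') \<in> D" using B x by (simp add: D_def smult_closed)
    qed
    then have "D = Id_on (carrier N) \<or> D = carrier N \<times> carrier N"
      using simple unfolding simple_semimodule_def by blast
    then show ?thesis
    proof
      assume "D = Id_on (carrier N)"
      then have "C \<subseteq> Id" using CD by (auto simp: Id_on_def)
      then show ?thesis using C_sub C_refl by auto
    next
      assume "D = carrier N \<times> carrier N"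
      then have "carrier Corner \<times> carrier Corner \<subseteq> C" using DC corner(1) by blast
      then show ?thesis using C_sub by blast
    qed
  qed
  ultimately show ?thesis
    unfolding simple_semimodule_def using left_semimodule_Corner by blast
qed

lemma entry_mat_annihilates_if_annihilates_Corner:
  assumes r: "r \<in> semimodule_annihilator R Corner"
  shows "E r \<in> semimodule_annihilator Mat N"
proof -
  have rR: "r \<in> carrier R" using r by (simp add: semimodule_annihilator_def)
  have "act (E r) x = \<zero>\<^bsub>N\<^esub>" if x: "x \<in> carrier N" for x
  proof -
    have "act (E \<one>) x \<in> carrier Corner" using x by (simp add: Corner_def E_act smult_closed)
    then have "act (E r) (act (E \<one>) x) = \<zero>\<^bsub>N\<^esub>"
      using r by (auto simp: semimodule_annihilator_def Corner_def)
    then show ?thesis using rR x by (simp add: E_act)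
  qed
  then show ?thesis using rR by (simp add: semimodule_annihilator_def)
qed

end

context square_matrices
begin

lemma simple_radical_Mat: "simple_radical Mat = matrices_over n (simple_radical R)"
proof (rule ideal_eq_matrices_over)
  show "hemiring_ideal Mat (simple_radical Mat)"
    by (rule simple_radical_ideal) (rule semiring_imp_hemiring[OF mat.semiring_axioms])
  show "simple_radical R \<subseteq> carrier R" by (auto simp: simple_radical_def)
  show "entry_mat 0 0 r \<in> simple_radical Mat \<longleftrightarrow> r \<in> simple_radical R" if r: "r \<in> carrier R" for r
  proof
    assume E: "entry_mat 0 0 r \<in> simple_radical Mat"
    have "r \<in> semimodule_annihilator R M" if M: "simple_semimodule R M" for M :: "('a, 'a) module"
    proof -
      interpret column_semimodule R n M
        using M square_matrices_axioms
        by (simp add: column_semimodule_def simple_semimodule_def)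
      show ?thesis
        using E r simple_radical_annihilates[OF simple_Col[OF M]]
        by (intro annihilates_if_entry_mat_annihilates_Col) auto
    qed
    then show "r \<in> simple_radical R" using r by (simp add: simple_radical_def)
  next
    assume rad: "r \<in> simple_radical R"
    have "entry_mat 0 0 r \<in> semimodule_annihilator Mat N"
      if N: "simple_semimodule Mat N" for N :: "('a mat, 'a mat) module"
    proof -
      interpret corner_semimodule R n N
        using N square_matrices_axioms
        by (simp add: corner_semimodule_def corner_semimodule_axioms_def simple_semimodule_def)
      show ?thesis
        using rad simple_radical_annihilates[OF simple_Corner]
        by (intro entry_mat_annihilates_if_annihilates_Corner) auto
    qed
    then show "entry_mat 0 0 r \<in> simple_radical Mat" using r by (simp add: simple_radical_def)
  qed
qed

end

section \<open>The Jacobson-Bourne radical\<close>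

text \<open>
  Without subtraction, the difference \<open>a - b\<close> is replaced by the pair \<open>(a, b)\<close>. Pairs multiply like
  differences and form a semiring, in which \<open>(0, 1)\<close> is central and plays the role of \<open>-1\<close>. The pairs
  \<open>(d, d)\<close> that stand for zero form an ideal. Right semiregularity then says that every pair \<open>i\<close> over
  the right ideal has a right quasi-inverse \<open>j\<close>, that is, \<open>i + j + i j\<close> lies on the diagonal.
\<close>

locale semiring_pairs = Ring.semiring R for R :: "('a, 'b) ring_scheme" (structure)
begin

definition Pairs :: "('a \<times> 'a) ring" where
  "Pairs = \<lparr>carrier = carrier R \<times> carrier R,
     mult = (\<lambda>(a, b) (c, d). (a \<otimes> c \<oplus> b \<otimes> d, a \<otimes> d \<oplus> b \<otimes> c)), one = (\<one>, \<zero>), zero = (\<zero>, \<zero>),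
     add = (\<lambda>(a, b) (c, d). (a \<oplus> c, b \<oplus> d))\<rparr>"

definition diag :: "('a \<times> 'a) set" where
  "diag = {(d, d) | d. d \<in> carrier R}"

definition neg_one :: "'a \<times> 'a" where
  "neg_one = (\<zero>, \<one>)"

sublocale P: Ring.semiring Pairs
  by unfold_locales (auto simp: Pairs_def a_ac m_assoc l_distr r_distr)

lemma diag_ideal: "hemiring_ideal Pairs diag"
  unfolding hemiring_ideal_def by (auto simp: Pairs_def diag_def a_comm)

lemma neg_one_closed [simp]: "neg_one \<in> carrier Pairs"
  by (simp add: neg_one_def Pairs_def)

lemma neg_one_commute: "x \<in> carrier Pairs \<Longrightarrow> x \<otimes>\<^bsub>Pairs\<^esub> neg_one = neg_one \<otimes>\<^bsub>Pairs\<^esub> x"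
  by (auto simp: neg_one_def Pairs_def)

lemma add_neg_one_diag: "x \<in> carrier Pairs \<Longrightarrow> x \<oplus>\<^bsub>Pairs\<^esub> neg_one \<otimes>\<^bsub>Pairs\<^esub> x \<in> diag"
  by (auto simp: neg_one_def Pairs_def diag_def a_comm)

lemma right_ideal_pairs:
  assumes "right_hemiring_ideal R I"
  shows "I \<times> I \<subseteq> carrier Pairs"
    and "\<lbrakk>x \<in> I \<times> I; y \<in> I \<times> I\<rbrakk> \<Longrightarrow> x \<oplus>\<^bsub>Pairs\<^esub> y \<in> I \<times> I"
    and "\<lbrakk>x \<in> I \<times> I; p \<in> carrier Pairs\<rbrakk> \<Longrightarrow> x \<otimes>\<^bsub>Pairs\<^esub> p \<in> I \<times> I"
  using assms by (auto simp: right_hemiring_ideal_def Pairs_def)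

lemma right_semiregular_iff_pairs:
  "right_semiregular R I \<longleftrightarrow> right_hemiring_ideal R I \<and>
     (\<forall>i\<in>I \<times> I. \<exists>j\<in>I \<times> I. i \<oplus>\<^bsub>Pairs\<^esub> j \<oplus>\<^bsub>Pairs\<^esub> i \<otimes>\<^bsub>Pairs\<^esub> j \<in> diag)"
proof -
  have "(i1, i2) \<oplus>\<^bsub>Pairs\<^esub> (j1, j2) \<oplus>\<^bsub>Pairs\<^esub> (i1, i2) \<otimes>\<^bsub>Pairs\<^esub> (j1, j2) \<in> diag \<longleftrightarrow>
      i1 \<oplus> j1 \<oplus> i1 \<otimes> j1 \<oplus> i2 \<otimes> j2 = i2 \<oplus> j2 \<oplus> i1 \<otimes> j2 \<oplus> i2 \<otimes> j1"
    if "i1 \<in> carrier R" "i2 \<in> carrier R" "j1 \<in> carrier R" "j2 \<in> carrier R" for i1 i2 j1 j2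
    using that by (auto simp: Pairs_def diag_def a_assoc)
  moreover have "x \<in> carrier R" if "right_hemiring_ideal R I" "x \<in> I" for x
    using that by (auto simp: right_hemiring_ideal_def)
  ultimately show ?thesis
    unfolding right_semiregular_def by (simp cong: conj_cong ball_cong bex_cong)
qed

lemma right_semiregularD:
  assumes "right_semiregular R I"
  shows "I \<subseteq> carrier R" "\<zero> \<in> I" "\<lbrakk>x \<in> I; y \<in> I\<rbrakk> \<Longrightarrow> x \<oplus> y \<in> I"
    and "\<lbrakk>x \<in> I; r \<in> carrier R\<rbrakk> \<Longrightarrow> x \<otimes> r \<in> I"
  using assms unfolding right_semiregular_def right_hemiring_ideal_def by blast+

text \<open>
  In a ring, \<open>y + b + a b = 0\<close> is solved by \<open>b = - (1 + a)\<inverse> y = - (y + c y)\<close>, where \<open>c\<close> is a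
  quasi-inverse of \<open>a\<close>. The same \<open>b\<close> works for pairs: with \<open>d = a + c + a c\<close>, the expression becomes
  \<open>(y - y) + d (- y)\<close>, and both summands lie on the diagonal.
\<close>

lemma right_semiregular_solve:
  assumes I: "right_semiregular R I" and "a1 \<in> I" "a2 \<in> I" "y1 \<in> I" "y2 \<in> I"
  shows "\<exists>b1\<in>I. \<exists>b2\<in>I. y1 \<oplus> b1 \<oplus> a1 \<otimes> b1 \<oplus> a2 \<otimes> b2 = y2 \<oplus> b2 \<oplus> a1 \<otimes> b2 \<oplus> a2 \<otimes> b1"
proof -
  have rI: "right_hemiring_ideal R I" using I by (simp add: right_semiregular_def)
  note closed = right_ideal_pairs[OF rI]
  define a y where "a = (a1, a2)" and "y = (y1, y2)"
  have ay: "a \<in> I \<times> I" "y \<in> I \<times> I" using assms by (simp_all add: a_def y_def)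
  then obtain c where c: "c \<in> I \<times> I" "a \<oplus>\<^bsub>Pairs\<^esub> c \<oplus>\<^bsub>Pairs\<^esub> a \<otimes>\<^bsub>Pairs\<^esub> c \<in> diag"
    using I unfolding right_semiregular_iff_pairs by blast
  have P: "a \<in> carrier Pairs" "y \<in> carrier Pairs" "c \<in> carrier Pairs" using ay c closed(1) by auto
  let ?d = "a \<oplus>\<^bsub>Pairs\<^esub> c \<oplus>\<^bsub>Pairs\<^esub> a \<otimes>\<^bsub>Pairs\<^esub> c"
  define b where "b = (y \<oplus>\<^bsub>Pairs\<^esub> c \<otimes>\<^bsub>Pairs\<^esub> y) \<otimes>\<^bsub>Pairs\<^esub> neg_one"
  have b: "b \<in> I \<times> I" unfolding b_def using ay c P by (intro closed) auto
  have "y \<oplus>\<^bsub>Pairs\<^esub> b \<oplus>\<^bsub>Pairs\<^esub> a \<otimes>\<^bsub>Pairs\<^esub> b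
      = (y \<oplus>\<^bsub>Pairs\<^esub> y \<otimes>\<^bsub>Pairs\<^esub> neg_one) \<oplus>\<^bsub>Pairs\<^esub> ?d \<otimes>\<^bsub>Pairs\<^esub> (y \<otimes>\<^bsub>Pairs\<^esub> neg_one)"
    using P by (simp add: b_def P.l_distr P.r_distr P.m_assoc P.a_ac)
  also have "\<dots> \<in> diag"
    using diag_ideal add_neg_one_diag[OF P(2)] c(2) P
    by (simp add: neg_one_commute hemiring_ideal_def)
  finally have "y \<oplus>\<^bsub>Pairs\<^esub> b \<oplus>\<^bsub>Pairs\<^esub> a \<otimes>\<^bsub>Pairs\<^esub> b \<in> diag" .
  moreover obtain b1 b2 where bb: "b = (b1, b2)" by force
  moreover have "I \<subseteq> carrier R" using rI by (simp add: right_hemiring_ideal_def)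
  ultimately show ?thesis
    using b assms(2-5)
    by (intro bexI[of _ b1] bexI[of _ b2]) (auto simp: Pairs_def diag_def a_def y_def a_assoc subset_iff)
qed

text \<open>
  For \<open>i = a + b\<close> one first chooses a quasi-inverse \<open>a'\<close> of \<open>a\<close>. This turns \<open>i\<close> into
  \<open>c = b + b a'\<close> up to the diagonal, which lies in the second right ideal and has a quasi-inverse
  \<open>b'\<close>; the quasi-inverse of \<open>i\<close> is the composite \<open>a' + b' + a' b'\<close>.
\<close>

lemma right_semiregular_sum:
  assumes I: "right_semiregular R I" and K: "right_semiregular R K"
  shows "right_semiregular R {x \<oplus> y | x y. x \<in> I \<and> y \<in> K}" (is "right_semiregular R ?S")
proof -
  have rI: "right_hemiring_ideal R I" and rK: "right_hemiring_ideal R K"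
    using I K by (simp_all add: right_semiregular_def)
  have IK: "I \<subseteq> carrier R" "K \<subseteq> carrier R" "\<zero> \<in> I" "\<zero> \<in> K"
    using rI rK by (auto simp: right_hemiring_ideal_def)
  have "right_hemiring_ideal R ?S"
    unfolding right_hemiring_ideal_def
  proof (intro conjI ballI)
    show "?S \<subseteq> carrier R" using IK by auto
    show "\<zero> \<in> ?S" using IK by (intro CollectI exI[of _ \<zero>]) simp
  next
    fix s t assume "s \<in> ?S" "t \<in> ?S"
    then obtain x y x' y' where *: "x \<in> I" "y \<in> K" "x' \<in> I" "y' \<in> K" "s = x \<oplus> y" "t = x' \<oplus> y'"
      by blast
    then have "x \<in> carrier R" "y \<in> carrier R" "x' \<in> carrier R" "y' \<in> carrier R" using IK by auto
    then have "s \<oplus> t = (x \<oplus> x') \<oplus> (y \<oplus> y')" using * by (simp add: a_ac)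
    moreover have "x \<oplus> x' \<in> I" "y \<oplus> y' \<in> K" using rI rK * by (simp_all add: right_hemiring_ideal_def)
    ultimately show "s \<oplus> t \<in> ?S" by blast
  next
    fix r s assume r: "r \<in> carrier R" and "s \<in> ?S"
    then obtain x y where *: "x \<in> I" "y \<in> K" "s = x \<oplus> y" by blast
    then have "s \<otimes> r = x \<otimes> r \<oplus> y \<otimes> r" using IK r by (simp add: l_distr subset_iff)
    moreover have "x \<otimes> r \<in> I" "y \<otimes> r \<in> K" using rI rK * r by (simp_all add: right_hemiring_ideal_def)
    ultimately show "s \<otimes> r \<in> ?S" by blast
  qed
  moreover have "\<exists>j\<in>?S \<times> ?S. i \<oplus>\<^bsub>Pairs\<^esub> j \<oplus>\<^bsub>Pairs\<^esub> i \<otimes>\<^bsub>Pairs\<^esub> j \<in> diag" if i: "i \<in> ?S \<times> ?S" for i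
  proof -
    note cI = right_ideal_pairs[OF rI] and cK = right_ideal_pairs[OF rK]
    have split: "x \<oplus>\<^bsub>Pairs\<^esub> y \<in> ?S \<times> ?S" if "x \<in> I \<times> I" "y \<in> K \<times> K" for x y
      using that by (auto simp: Pairs_def)
    obtain x1 y1 x2 y2 where xy: "x1 \<in> I" "y1 \<in> K" "x2 \<in> I" "y2 \<in> K" "i = (x1 \<oplus> y1, x2 \<oplus> y2)"
      using i by auto
    define a b where "a = (x1, x2)" and "b = (y1, y2)"
    have ab: "a \<in> I \<times> I" "b \<in> K \<times> K" "i = a \<oplus>\<^bsub>Pairs\<^esub> b"
      using xy by (simp_all add: a_def b_def Pairs_def)
    obtain a' where a': "a' \<in> I \<times> I" "a \<oplus>\<^bsub>Pairs\<^esub> a' \<oplus>\<^bsub>Pairs\<^esub> a \<otimes>\<^bsub>Pairs\<^esub> a' \<in> diag"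
      using I ab(1) unfolding right_semiregular_iff_pairs by blast
    have P: "a \<in> carrier Pairs" "b \<in> carrier Pairs" "a' \<in> carrier Pairs"
      using ab a' cI(1) cK(1) by auto
    define c where "c = b \<oplus>\<^bsub>Pairs\<^esub> b \<otimes>\<^bsub>Pairs\<^esub> a'"
    have c: "c \<in> K \<times> K" unfolding c_def using ab P by (intro cK)
    obtain b' where b': "b' \<in> K \<times> K" "c \<oplus>\<^bsub>Pairs\<^esub> b' \<oplus>\<^bsub>Pairs\<^esub> c \<otimes>\<^bsub>Pairs\<^esub> b' \<in> diag"
      using K c unfolding right_semiregular_iff_pairs by blast
    have P': "b' \<in> carrier Pairs" using b' cK(1) by auto
    let ?d = "a \<oplus>\<^bsub>Pairs\<^esub> a' \<oplus>\<^bsub>Pairs\<^esub> a \<otimes>\<^bsub>Pairs\<^esub> a'" and ?e = "c \<oplus>\<^bsub>Pairs\<^esub> b' \<oplus>\<^bsub>Pairs\<^esub> c \<otimes>\<^bsub>Pairs\<^esub> b'"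
    let ?j = "(a' \<oplus>\<^bsub>Pairs\<^esub> a' \<otimes>\<^bsub>Pairs\<^esub> b') \<oplus>\<^bsub>Pairs\<^esub> b'"
    have "i \<oplus>\<^bsub>Pairs\<^esub> ?j \<oplus>\<^bsub>Pairs\<^esub> i \<otimes>\<^bsub>Pairs\<^esub> ?j = ?d \<oplus>\<^bsub>Pairs\<^esub> ?d \<otimes>\<^bsub>Pairs\<^esub> b' \<oplus>\<^bsub>Pairs\<^esub> ?e"
      using P P' by (simp add: ab(3) c_def P.l_distr P.r_distr P.m_assoc P.a_ac)
    also have "\<dots> \<in> diag"
      using diag_ideal a'(2) b'(2) P' by (simp add: hemiring_ideal_def)
    finally have "i \<oplus>\<^bsub>Pairs\<^esub> ?j \<oplus>\<^bsub>Pairs\<^esub> i \<otimes>\<^bsub>Pairs\<^esub> ?j \<in> diag" .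
    moreover have "?j \<in> ?S \<times> ?S" using a' b' P' by (intro split cI)
    ultimately show ?thesis by (rule bexI)
  qed
  ultimately show ?thesis unfolding right_semiregular_iff_pairs by (intro conjI ballI)
qed

text \<open>
  This is the analogue of the fact that \<open>1 + r x\<close> is right invertible whenever \<open>1 + x r\<close> is. Solving
  \<open>x + b + (x r) b = 0\<close> inside the right ideal and multiplying by \<open>r\<close> shows that \<open>r b\<close> is a
  quasi-inverse of \<open>r x\<close>. It makes the radical a two-sided ideal.
\<close>

lemma right_semiregular_left_mult:
  assumes I: "right_semiregular R I" and r: "r \<in> carrier R"
  shows "right_semiregular R ((\<lambda>x. r \<otimes> x) ` I)" (is "right_semiregular R ?rI")
proof -
  have rI: "right_hemiring_ideal R I" using I by (simp add: right_semiregular_def)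
  have sub: "x \<in> carrier R" if "x \<in> I" for x using that rI by (auto simp: right_hemiring_ideal_def)
  have "right_hemiring_ideal R ?rI"
    unfolding right_hemiring_ideal_def
  proof (intro conjI ballI)
    show "?rI \<subseteq> carrier R" using sub r by auto
    show "\<zero> \<in> ?rI" using rI r by (intro image_eqI[of _ _ \<zero>]) (simp_all add: right_hemiring_ideal_def)
  next
    fix x y assume "x \<in> ?rI" "y \<in> ?rI"
    then obtain u v where uv: "u \<in> I" "v \<in> I" "x = r \<otimes> u" "y = r \<otimes> v" by blast
    then show "x \<oplus> y \<in> ?rI"
      using rI r by (intro image_eqI[of _ _ "u \<oplus> v"]) (simp_all add: r_distr sub right_hemiring_ideal_def)
  next
    fix s x assume s: "s \<in> carrier R" and "x \<in> ?rI"
    then obtain u where u: "u \<in> I" "x = r \<otimes> u" by blast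
    then show "x \<otimes> s \<in> ?rI"
      using rI r s by (intro image_eqI[of _ _ "u \<otimes> s"]) (simp_all add: m_assoc sub right_hemiring_ideal_def)
  qed
  moreover have "\<exists>j1\<in>?rI. \<exists>j2\<in>?rI. i1 \<oplus> j1 \<oplus> i1 \<otimes> j1 \<oplus> i2 \<otimes> j2 = i2 \<oplus> j2 \<oplus> i1 \<otimes> j2 \<oplus> i2 \<otimes> j1"
    if "i1 \<in> ?rI" "i2 \<in> ?rI" for i1 i2
  proof -
    obtain x1 x2 where x: "x1 \<in> I" "x2 \<in> I" "i1 = r \<otimes> x1" "i2 = r \<otimes> x2" using \<open>i1 \<in> ?rI\<close> \<open>i2 \<in> ?rI\<close> by blast
    have "x1 \<otimes> r \<in> I" "x2 \<otimes> r \<in> I" using x rI r by (simp_all add: right_hemiring_ideal_def)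
    then obtain b1 b2 where b: "b1 \<in> I" "b2 \<in> I"
      "x1 \<oplus> b1 \<oplus> (x1 \<otimes> r) \<otimes> b1 \<oplus> (x2 \<otimes> r) \<otimes> b2 = x2 \<oplus> b2 \<oplus> (x1 \<otimes> r) \<otimes> b2 \<oplus> (x2 \<otimes> r) \<otimes> b1"
      using right_semiregular_solve[OF I, of "x1 \<otimes> r" "x2 \<otimes> r" x1 x2] x by blast
    have "r \<otimes> (x1 \<oplus> b1 \<oplus> (x1 \<otimes> r) \<otimes> b1 \<oplus> (x2 \<otimes> r) \<otimes> b2)
        = r \<otimes> (x2 \<oplus> b2 \<oplus> (x1 \<otimes> r) \<otimes> b2 \<oplus> (x2 \<otimes> r) \<otimes> b1)" using b by simp
    then have "i1 \<oplus> r \<otimes> b1 \<oplus> i1 \<otimes> (r \<otimes> b1) \<oplus> i2 \<otimes> (r \<otimes> b2)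
        = i2 \<oplus> r \<otimes> b2 \<oplus> i1 \<otimes> (r \<otimes> b2) \<oplus> i2 \<otimes> (r \<otimes> b1)"
      using x b r by (simp add: r_distr m_assoc sub)
    then show ?thesis using b by blast
  qed
  ultimately show ?thesis unfolding right_semiregular_def by blast
qed

lemma right_semiregular_zero: "right_semiregular R {\<zero>}"
  by (simp add: right_semiregular_def right_hemiring_ideal_def)

lemma jacobson_radical_eq_Union: "jacobson_radical R = \<Union> {I. right_semiregular R I}"
proof (intro equalityI subsetI)
  fix x assume "x \<in> jacobson_radical R"
  then obtain F f where F: "finite F" "F \<subseteq> {I. right_semiregular R I}" "\<forall>I\<in>F. f I \<in> I"
    and x: "x = (\<Oplus>I\<in>F. f I)" unfolding jacobson_radical_def by blast
  from F have "\<exists>K. right_semiregular R K \<and> (\<Oplus>I\<in>F. f I) \<in> K"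
  proof (induction F rule: finite_induct)
    case empty
    then show ?case using right_semiregular_zero by auto
  next
    case (insert I F)
    then obtain K where K: "right_semiregular R K" "(\<Oplus>I\<in>F. f I) \<in> K" by auto
    have I: "right_semiregular R I" "f I \<in> I" using insert.prems by auto
    have "f J \<in> carrier R" if "J \<in> insert I F" for J
      using insert.prems that right_semiregularD(1) by blast
    then have "(\<Oplus>J\<in>insert I F. f J) = f I \<oplus> (\<Oplus>J\<in>F. f J)" using insert.hyps by (intro finsum_insert) auto
    then show ?case using right_semiregular_sum[OF I(1) K(1)] I(2) K(2) by blast
  qed
  then show "x \<in> \<Union> {I. right_semiregular R I}" using x by blast
next
  fix x assume "x \<in> \<Union> {I. right_semiregular R I}"
  then obtain I where I: "right_semiregular R I" "x \<in> I" by blast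
  then have "x \<in> carrier R" using right_semiregularD(1) by blast
  then have "x = (\<Oplus>J\<in>{I}. x)" by simp
  then show "x \<in> jacobson_radical R"
    unfolding jacobson_radical_def using I by (intro CollectI exI[of _ "{I}"] exI[of _ "\<lambda>_. x"]) auto
qed

lemma jacobson_radical_directed:
  assumes "x \<in> jacobson_radical R" "y \<in> jacobson_radical R"
  obtains I where "right_semiregular R I" "x \<in> I" "y \<in> I"
proof -
  obtain I K where I: "right_semiregular R I" "x \<in> I" and K: "right_semiregular R K" "y \<in> K"
    using assms unfolding jacobson_radical_eq_Union by blast
  have zero: "\<zero> \<in> I" "\<zero> \<in> K" and xy: "x \<in> carrier R" "y \<in> carrier R"
    using I K right_semiregularD(1,2) by blast+
  have "x = x \<oplus> \<zero>" "y = \<zero> \<oplus> y" using xy by simp_all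
  then have "x \<in> {x \<oplus> y | x y. x \<in> I \<and> y \<in> K}" "y \<in> {x \<oplus> y | x y. x \<in> I \<and> y \<in> K}"
    using I K zero by blast+
  then show thesis using that right_semiregular_sum[OF I(1) K(1)] by blast
qed

lemma jacobson_radical_ideal: "hemiring_ideal R (jacobson_radical R)"
  unfolding hemiring_ideal_def
proof (intro conjI ballI)
  show "jacobson_radical R \<subseteq> carrier R"
    unfolding jacobson_radical_eq_Union using right_semiregularD(1) by blast
  show "\<zero> \<in> jacobson_radical R" unfolding jacobson_radical_eq_Union using right_semiregular_zero by blast
next
  fix x y assume "x \<in> jacobson_radical R" "y \<in> jacobson_radical R"
  then obtain I where I: "right_semiregular R I" "x \<in> I" "y \<in> I" by (rule jacobson_radical_directed)
  then have "x \<oplus> y \<in> I" by (intro right_semiregularD(3))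
  then show "x \<oplus> y \<in> jacobson_radical R" using I(1) unfolding jacobson_radical_eq_Union by blast
next
  fix r x assume r: "r \<in> carrier R" and "x \<in> jacobson_radical R"
  then obtain I where I: "right_semiregular R I" "x \<in> I" unfolding jacobson_radical_eq_Union by blast
  then have "x \<otimes> r \<in> I" using r by (intro right_semiregularD(4))
  then show "x \<otimes> r \<in> jacobson_radical R" using I(1) unfolding jacobson_radical_eq_Union by blast
  show "r \<otimes> x \<in> jacobson_radical R"
    using right_semiregular_left_mult[OF I(1) r] I(2) unfolding jacobson_radical_eq_Union by blast
qed

lemma right_semiregular_jacobson_radical: "right_semiregular R (jacobson_radical R)"
proof -
  have "right_hemiring_ideal R (jacobson_radical R)"
    using jacobson_radical_ideal by (simp add: hemiring_ideal_def right_hemiring_ideal_def)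
  moreover have "\<exists>j1\<in>jacobson_radical R. \<exists>j2\<in>jacobson_radical R.
      i1 \<oplus> j1 \<oplus> i1 \<otimes> j1 \<oplus> i2 \<otimes> j2 = i2 \<oplus> j2 \<oplus> i1 \<otimes> j2 \<oplus> i2 \<otimes> j1"
    if i: "i1 \<in> jacobson_radical R" "i2 \<in> jacobson_radical R" for i1 i2
  proof -
    obtain I where I: "right_semiregular R I" "i1 \<in> I" "i2 \<in> I"
      using i by (rule jacobson_radical_directed)
    then obtain j1 j2 where "j1 \<in> I" "j2 \<in> I"
      "i1 \<oplus> j1 \<oplus> i1 \<otimes> j1 \<oplus> i2 \<otimes> j2 = i2 \<oplus> j2 \<oplus> i1 \<otimes> j2 \<oplus> i2 \<otimes> j1"
      unfolding right_semiregular_def by blast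
    then show ?thesis using I(1) unfolding jacobson_radical_eq_Union by blast
  qed
  ultimately show ?thesis unfolding right_semiregular_def by blast
qed

end

context square_matrices
begin

interpretation R: semiring_pairs R by unfold_locales
interpretation M: semiring_pairs Mat by unfold_locales

text \<open>
  Take the corner entry of a quasi-inverse of \<open>entry_mat 0 0 r\<close>. It remains in the corner of the
  radical because the radical is a two-sided ideal, which is determined by its entries.
\<close>

lemma corner_of_jacobson_radical_Mat:
  assumes r: "r \<in> carrier R" and "entry_mat 0 0 r \<in> jacobson_radical Mat"
  shows "r \<in> jacobson_radical R"
proof -
  define L where "L = {r \<in> carrier R. entry_mat 0 0 r \<in> jacobson_radical Mat}"
  have "right_hemiring_ideal R L"
    using corner_ideal[OF M.jacobson_radical_ideal]
    unfolding L_def hemiring_ideal_def right_hemiring_ideal_def by simp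
  moreover have "\<exists>j1\<in>L. \<exists>j2\<in>L. i1 \<oplus> j1 \<oplus> i1 \<otimes> j1 \<oplus> i2 \<otimes> j2 = i2 \<oplus> j2 \<oplus> i1 \<otimes> j2 \<oplus> i2 \<otimes> j1"
    if i: "i1 \<in> L" "i2 \<in> L" for i1 i2
  proof -
    let ?E = "entry_mat 0 0"
    obtain B1 B2 where B: "B1 \<in> jacobson_radical Mat" "B2 \<in> jacobson_radical Mat"
      and eq: "?E i1 \<oplus>\<^bsub>Mat\<^esub> B1 \<oplus>\<^bsub>Mat\<^esub> ?E i1 \<otimes>\<^bsub>Mat\<^esub> B1 \<oplus>\<^bsub>Mat\<^esub> ?E i2 \<otimes>\<^bsub>Mat\<^esub> B2
        = ?E i2 \<oplus>\<^bsub>Mat\<^esub> B2 \<oplus>\<^bsub>Mat\<^esub> ?E i1 \<otimes>\<^bsub>Mat\<^esub> B2 \<oplus>\<^bsub>Mat\<^esub> ?E i2 \<otimes>\<^bsub>Mat\<^esub> B1"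
      using M.right_semiregular_jacobson_radical i unfolding right_semiregular_def L_def by blast
    have BM: "B1 \<in> carrier Mat" "B2 \<in> carrier Mat"
      using B M.jacobson_radical_ideal by (auto simp: hemiring_ideal_def)
    have iR: "i1 \<in> carrier R" "i2 \<in> carrier R" using i by (simp_all add: L_def)
    have "B $$ (0, 0) \<in> L" if "B \<in> jacobson_radical Mat" "B \<in> carrier Mat" for B
      using ideal_entries[OF M.jacobson_radical_ideal that(2)] that dim_pos
      by (simp add: L_def entry_closed)
    then have "B1 $$ (0, 0) \<in> L" "B2 $$ (0, 0) \<in> L" using B BM by blast+
    moreover have "i1 \<oplus> B1 $$ (0, 0) \<oplus> i1 \<otimes> B1 $$ (0, 0) \<oplus> i2 \<otimes> B2 $$ (0, 0)
        = i2 \<oplus> B2 $$ (0, 0) \<oplus> i1 \<otimes> B2 $$ (0, 0) \<oplus> i2 \<otimes> B1 $$ (0, 0)"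
      using arg_cong[OF eq, of "\<lambda>A. A $$ (0, 0)"] BM iR dim_pos
      by (simp add: add_entry entry_mat_mult_entry entry_mat_entry)
    ultimately show ?thesis by blast
  qed
  ultimately have "right_semiregular R L" unfolding right_semiregular_def by blast
  then show ?thesis using assms unfolding R.jacobson_radical_eq_Union L_def by blast
qed

text \<open>
  The matrices over the radical that are supported in row \<open>0\<close> form a right ideal. Multiplying two of
  them involves only the corner entry of the left factor, so the quasi-inverse of such a matrix is
  found by solving \<open>y + b + a b = 0\<close> for each column separately, with \<open>a\<close> the corner entry.
\<close>

lemma entry_mat_jacobson_radical:
  assumes r: "r \<in> jacobson_radical R"
  shows "entry_mat 0 0 r \<in> jacobson_radical Mat"
proof -
  let ?J = "jacobson_radical R"
  have J: "hemiring_ideal R ?J" by (rule R.jacobson_radical_ideal)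
  have JR: "x \<in> carrier R" if "x \<in> ?J" for x using that J by (auto simp: hemiring_ideal_def)
  have zero: "\<zero> \<in> ?J" using J by (simp add: hemiring_ideal_def)
  define I where "I = {A \<in> matrices_over n ?J. \<forall>i<n. \<forall>j<n. i \<noteq> 0 \<longrightarrow> A $$ (i, j) = \<zero>}"
  have MJ: "hemiring_ideal Mat (matrices_over n ?J)" using J by (rule matrices_over_ideal)
  have IM: "A \<in> carrier Mat" if "A \<in> I" for A using that MJ by (auto simp: I_def hemiring_ideal_def)
  have IJ: "A $$ (0, j) \<in> ?J" if "A \<in> I" "j < n" for A j
    using that dim_pos by (auto simp: I_def matrices_over_def)
  have I0: "A $$ (i, j) = \<zero>" if "A \<in> I" "i < n" "j < n" "i \<noteq> 0" for A i j
    using that by (simp add: I_def)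
  have mult: "(A \<otimes>\<^bsub>Mat\<^esub> B) $$ (i, j) = (if i = 0 then A $$ (0, 0) \<otimes> B $$ (0, j) else \<zero>)"
    if "A \<in> I" "B \<in> I" "i < n" "j < n" for A B i j
  proof -
    have "(A \<otimes>\<^bsub>Mat\<^esub> B) $$ (i, j) = A $$ (i, 0) \<otimes> B $$ (0, j)"
      unfolding mult_entry[OF that(3,4)] using that dim_pos
      by (intro finsum_single_term) (auto simp: I0 entry_closed[OF IM])
    then show ?thesis using that dim_pos by (simp add: I0 entry_closed[OF IM])
  qed
  have "right_hemiring_ideal Mat I"
    unfolding right_hemiring_ideal_def
  proof (intro conjI ballI)
    show "I \<subseteq> carrier Mat" using IM by blast
    show "\<zero>\<^bsub>Mat\<^esub> \<in> I" using MJ by (simp add: I_def hemiring_ideal_def zero_entry)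
  next
    fix A B assume "A \<in> I" "B \<in> I"
    then show "A \<oplus>\<^bsub>Mat\<^esub> B \<in> I" using MJ by (simp add: I_def hemiring_ideal_def add_entry)
  next
    fix B A assume B: "B \<in> carrier Mat" and A: "A \<in> I"
    have "(A \<otimes>\<^bsub>Mat\<^esub> B) $$ (i, j) = \<zero>" if "i < n" "j < n" "i \<noteq> 0" for i j
    proof -
      have "(A \<otimes>\<^bsub>Mat\<^esub> B) $$ (i, j) = (\<Oplus>k\<in>{..<n}. \<zero>)"
        unfolding mult_entry[OF that(1,2)] using that A B
        by (intro finsum_cong') (auto simp: I0 entry_closed)
      then show ?thesis by simp
    qed
    then show "A \<otimes>\<^bsub>Mat\<^esub> B \<in> I" using MJ A B by (simp add: I_def hemiring_ideal_def)
  qed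
  moreover have "\<exists>B1\<in>I. \<exists>B2\<in>I.
      A1 \<oplus>\<^bsub>Mat\<^esub> B1 \<oplus>\<^bsub>Mat\<^esub> A1 \<otimes>\<^bsub>Mat\<^esub> B1 \<oplus>\<^bsub>Mat\<^esub> A2 \<otimes>\<^bsub>Mat\<^esub> B2
      = A2 \<oplus>\<^bsub>Mat\<^esub> B2 \<oplus>\<^bsub>Mat\<^esub> A1 \<otimes>\<^bsub>Mat\<^esub> B2 \<oplus>\<^bsub>Mat\<^esub> A2 \<otimes>\<^bsub>Mat\<^esub> B1"
    if A: "A1 \<in> I" "A2 \<in> I" for A1 A2
  proof -
    define a1 a2 where "a1 = A1 $$ (0, 0)" and "a2 = A2 $$ (0, 0)"
    have a: "a1 \<in> ?J" "a2 \<in> ?J" using A dim_pos by (simp_all add: IJ a1_def a2_def)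
    have "\<exists>b1\<in>?J. \<exists>b2\<in>?J. j < n \<longrightarrow>
        A1 $$ (0, j) \<oplus> b1 \<oplus> a1 \<otimes> b1 \<oplus> a2 \<otimes> b2 = A2 $$ (0, j) \<oplus> b2 \<oplus> a1 \<otimes> b2 \<oplus> a2 \<otimes> b1" for j
      using R.right_semiregular_solve[OF R.right_semiregular_jacobson_radical a IJ[OF A(1)] IJ[OF A(2)], of j j]
        zero by (cases "j < n") (simp, blast)
    then obtain b1 b2 where b: "\<And>j. b1 j \<in> ?J" "\<And>j. b2 j \<in> ?J"
      and eq: "\<And>j. j < n \<Longrightarrow> A1 $$ (0, j) \<oplus> b1 j \<oplus> a1 \<otimes> b1 j \<oplus> a2 \<otimes> b2 j
        = A2 $$ (0, j) \<oplus> b2 j \<oplus> a1 \<otimes> b2 j \<oplus> a2 \<otimes> b1 j" by metis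
    define row where "row b = mat n n (\<lambda>(i, j). if i = 0 then b j else \<zero>)" for b :: "nat \<Rightarrow> 'a"
    have row: "row b \<in> I" if "\<And>j. b j \<in> ?J" for b
      unfolding row_def I_def using that zero by (auto intro!: mat_in_matrices_over)
    have row_entry: "row b $$ (i, j) = (if i = 0 then b j else \<zero>)" if "i < n" "j < n" for b i j
      using that by (simp add: row_def)
    have B: "row b1 \<in> I" "row b2 \<in> I" using b by (auto intro: row)
    show ?thesis
    proof (intro bexI)
      show "A1 \<oplus>\<^bsub>Mat\<^esub> row b1 \<oplus>\<^bsub>Mat\<^esub> A1 \<otimes>\<^bsub>Mat\<^esub> row b1 \<oplus>\<^bsub>Mat\<^esub> A2 \<otimes>\<^bsub>Mat\<^esub> row b2
        = A2 \<oplus>\<^bsub>Mat\<^esub> row b2 \<oplus>\<^bsub>Mat\<^esub> A1 \<otimes>\<^bsub>Mat\<^esub> row b2 \<oplus>\<^bsub>Mat\<^esub> A2 \<otimes>\<^bsub>Mat\<^esub> row b1" (is "?l = ?r")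
      proof (rule Mat_eqI)
        show "?l \<in> carrier Mat" "?r \<in> carrier Mat" using A B by (simp_all add: IM)
        fix i j assume ij: "i < n" "j < n"
        show "?l $$ (i, j) = ?r $$ (i, j)"
          using ij A B eq[OF ij(2)] dim_pos
          by (cases "i = 0") (simp_all add: add_entry mult row_entry I0 a1_def a2_def)
      qed
    qed (use B in auto)
  qed
  ultimately have "right_semiregular Mat I" unfolding right_semiregular_def by blast
  moreover have "entry_mat 0 0 r \<in> I"
    unfolding I_def using r zero by (auto simp: entry_mat_entry entry_mat_def intro!: mat_in_matrices_over)
  ultimately show ?thesis unfolding M.jacobson_radical_eq_Union by blast
qed

lemma jacobson_radical_Mat: "jacobson_radical Mat = matrices_over n (jacobson_radical R)"
proof (rule ideal_eq_matrices_over)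
  show "hemiring_ideal Mat (jacobson_radical Mat)" by (rule M.jacobson_radical_ideal)
  show "jacobson_radical R \<subseteq> carrier R" using R.jacobson_radical_ideal by (simp add: hemiring_ideal_def)
  show "entry_mat 0 0 r \<in> jacobson_radical Mat \<longleftrightarrow> r \<in> jacobson_radical R" if "r \<in> carrier R" for r
    using corner_of_jacobson_radical_Mat[OF that] entry_mat_jacobson_radical[of r] by blast
qed

end

section \<open>The radicals of a matrix semiring\<close>

theorem theorem5p8:
  fixes R :: "('a, 'b) ring_scheme" and n :: nat
  assumes "Ring.semiring R" and "n \<ge> 1"
  shows "brown_mccoy_radical (matrix_semiring n R) = matrices_over n (brown_mccoy_radical R) \<and>
    simple_radical (matrix_semiring n R) = matrices_over n (simple_radical R) \<and>
    jacobson_radical (matrix_semiring n R) = matrices_over n (jacobson_radical R)"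
proof -
  interpret square_matrices R n
    using assms by (simp add: square_matrices_def square_matrices_axioms_def)
  show ?thesis
    by (intro conjI brown_mccoy_radical_Mat simple_radical_Mat jacobson_radical_Mat)
qed

end
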